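(* Let $T$ be a tree on $n$ vertices with $\ell$ leaves and $s$ support vertices. Then $$\gamma_2^0(T) \geq \frac{n-\ell-s+4}{5}.$$ Moreover, equality holds if and only if $T\in \mathcal{F}_2$, where $$\mathcal{F}_2 = \{ T:\ T \text{ a tree},\ d(x,y) \equiv 2 \pmod{5} \text{ for all distinct } x, y \in S(T)\} \setminus \{K_{1,m}:\ m \geq 2\}.$$
   Context: A leaf of a tree is a vertex of degree 1; a support vertex is a vertex adjacent to a leaf; $S(T)$ denotes the set of support vertices of $T$. $d(x,y)$ is the distance in $T$. $\gamma_2^0(T)$ (the $2$-distance domination number) is the minimum size of a set $X\subseteq V(T)$ such that every vertex of $V(T)\setminus X$ is at distance at most $2$ from some vertex of $X$. *)

theory Defs
  imports "Graph_Theory.Graph_Theory"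
begin

text \<open>
  A finite simple graph is a \<^const>\<open>pair_graph\<close>, i.e. a finite, loop-free, symmetric set of arcs, so
  each edge is represented by two opposite arcs. The library's \<^const>\<open>tree\<close> is meant for digraphs and
  is not usable here: the closed walk \<open>u, v, u\<close> along an edge is a \<^const>\<open>pre_digraph.cycle\<close>.
  The cycles of the undirected graph are those of length at least 3.
  Connectedness in the library includes having at least one vertex.
\<close>

definition is_tree :: "'a pair_pre_digraph \<Rightarrow> bool" where
  "is_tree T \<longleftrightarrow> pair_graph T \<and> Digraph_Component.connected (with_proj T) \<and>
     \<not> (\<exists>c. pre_digraph.cycle (with_proj T) c \<and> 3 \<le> length c)"

text \<open>By symmetry the degree of a vertex is its \<^const>\<open>out_degree\<close>.\<close>

definition leaves :: "'a pair_pre_digraph \<Rightarrow> 'a set" where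
  "leaves T = {v \<in> pverts T. out_degree (with_proj T) v = 1}"

definition support_verts :: "'a pair_pre_digraph \<Rightarrow> 'a set" where
  "support_verts T = {v \<in> pverts T. \<exists>w \<in> leaves T. (v, w) \<in> parcs T}"

text \<open>Unspecified if no path from \<open>u\<close> to \<open>v\<close> exists, which does not happen in a connected graph.\<close>

definition gdist :: "'a pair_pre_digraph \<Rightarrow> 'a \<Rightarrow> 'a \<Rightarrow> nat" where
  "gdist T u v = (LEAST k. \<exists>p. pre_digraph.apath (with_proj T) u p v \<and> length p = k)"

definition distance_dominating :: "nat \<Rightarrow> 'a pair_pre_digraph \<Rightarrow> 'a set \<Rightarrow> bool" where
  "distance_dominating k T X \<longleftrightarrow>
     X \<subseteq> pverts T \<and> (\<forall>v \<in> pverts T - X. \<exists>x \<in> X. gdist T v x \<le> k)"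

definition distance_domination_number :: "nat \<Rightarrow> 'a pair_pre_digraph \<Rightarrow> nat" where
  "distance_domination_number k T = (LEAST m. \<exists>X. distance_dominating k T X \<and> card X = m)"

definition family_F2 :: "'a pair_pre_digraph set" where
  "family_F2 =
     {T. is_tree T \<and>
        (\<forall>x \<in> support_verts T. \<forall>y \<in> support_verts T. x \<noteq> y \<longrightarrow> gdist T x y mod 5 = 2)}
     - {T. \<exists>m \<ge> 2. complete_bipartite_digraph 1 m (with_proj T)}"

end

theory Submission
  imports Defs
begin

text \<open>
  Cutting a tree at an edge leaves two trees with unchanged distances, and it raises
  \<open>\<ell> + s\<close> by at most 4: each end of the edge may become a leaf and make its neighbour a support vertex.

  \<^emph>\<open>Lower bound.\<close> Given a dominating set \<open>X\<close> with at least two vertices, cut at a middle edge of a path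
  between two closest vertices of \<open>X\<close>: both parts are dominated by their share of \<open>X\<close>.
  A tree of radius at most 2 has at most one vertex that is neither a leaf nor a support vertex.
  Equality forces every cut to create two new leaves and two new support vertices,
  so support vertices \<open>x\<close>, \<open>y\<close> on opposite sides of a cut \<open>uv\<close> satisfy
  \<open>d(x,y) = d(x,u) + 1 + d(v,y)\<close>, which is \<open>3 + 1 + 3 = 2\<close> modulo 5.

  \<^emph>\<open>Converse.\<close> If two support vertices are at distance \<open>5j + 2\<close> with \<open>j \<ge> 1\<close>, everything branches off the
  path \<open>p\<close> between them at positions \<open>1\<close> modulo 5, so cutting the edge between \<open>p 3\<close> and \<open>p 4\<close> gives two smaller
  trees of the family. If all these distances are 2, the common neighbour of the support vertices
  dominates the tree.
\<close>

section \<open>Trees as metric spaces\<close>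

text \<open>
  The edges are the pairs at distance 1. Only distances are mentioned, so the two sides of an edge
  are models for the same \<open>d\<close>.
\<close>

locale tree_metric =
  fixes V :: "'a set" and d :: "'a \<Rightarrow> 'a \<Rightarrow> nat"
  assumes finite_V: "finite V"
    and V_nonempty: "V \<noteq> {}"
    and dist_0: "\<And>x y. x \<in> V \<Longrightarrow> y \<in> V \<Longrightarrow> d x y = 0 \<longleftrightarrow> x = y"
    and dist_sym: "\<And>x y. x \<in> V \<Longrightarrow> y \<in> V \<Longrightarrow> d x y = d y x"
    and dist_tri: "\<And>x y z. x \<in> V \<Longrightarrow> y \<in> V \<Longrightarrow> z \<in> V \<Longrightarrow> d x z \<le> d x y + d y z"
    and first_step: "\<And>x y. x \<in> V \<Longrightarrow> y \<in> V \<Longrightarrow> x \<noteq> y \<Longrightarrow> \<exists>w\<in>V. d x w = 1 \<and> d x y = Suc (d w y)"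
    and edge_neq: "\<And>u v w. u \<in> V \<Longrightarrow> v \<in> V \<Longrightarrow> w \<in> V \<Longrightarrow> d u v = 1 \<Longrightarrow> d w u \<noteq> d w v"
    and edge_cut: "\<And>u v w z. u \<in> V \<Longrightarrow> v \<in> V \<Longrightarrow> w \<in> V \<Longrightarrow> z \<in> V \<Longrightarrow> d u v = 1 \<Longrightarrow>
        d w u < d w v \<Longrightarrow> d z v < d z u \<Longrightarrow> d w z = d w u + 1 + d v z"

text \<open>The vertex set is a parameter because a cut changes \<open>V\<close> but keeps
  \<open>d\<close>; adjacency is distance 1.\<close>

definition metric_leaves :: "'a set \<Rightarrow> ('a \<Rightarrow> 'a \<Rightarrow> nat) \<Rightarrow> 'a set" where
  "metric_leaves V d = {v \<in> V. \<exists>!w. w \<in> V \<and> d v w = 1}"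

definition metric_supports :: "'a set \<Rightarrow> ('a \<Rightarrow> 'a \<Rightarrow> nat) \<Rightarrow> 'a set" where
  "metric_supports V d = {v \<in> V. \<exists>w \<in> metric_leaves V d. d v w = 1}"

definition supports_2_mod_5 :: "'a set \<Rightarrow> ('a \<Rightarrow> 'a \<Rightarrow> nat) \<Rightarrow> bool" where
  "supports_2_mod_5 V d \<longleftrightarrow>
     (\<forall>x \<in> metric_supports V d. \<forall>y \<in> metric_supports V d. x \<noteq> y \<longrightarrow> d x y mod 5 = 2)"

text \<open>For an edge \<open>uv\<close> of a tree this is the component of \<open>u\<close> once
  \<open>uv\<close> is removed.\<close>

definition edge_side :: "'a set \<Rightarrow> ('a \<Rightarrow> 'a \<Rightarrow> nat) \<Rightarrow> 'a \<Rightarrow> 'a \<Rightarrow> 'a set" where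
  "edge_side V d u v = {w \<in> V. d w u < d w v}"

lemma finite_ex_max:
  fixes f :: "'a \<Rightarrow> nat"
  assumes "finite B" "B \<noteq> {}"
  shows "\<exists>q\<in>B. \<forall>w\<in>B. f w \<le> f q"
proof -
  have "Max (f ` B) \<in> f ` B" using assms by simp
  then obtain q where "q \<in> B" "Max (f ` B) = f q" by (rule imageE)
  then show ?thesis using assms by (metis Max_ge finite_imageI imageI)
qed

section \<open>The two sides of an edge\<close>

context tree_metric
begin

lemma leaves_subset: "metric_leaves V d \<subseteq> V" and supports_subset: "metric_supports V d \<subseteq> V"
  by (auto simp: metric_leaves_def metric_supports_def)

lemma finite_leaves: "finite (metric_leaves V d)" and finite_supports: "finite (metric_supports V d)"
  using leaves_subset supports_subset finite_V by (auto intro: finite_subset)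

lemma dist_self: "x \<in> V \<Longrightarrow> d x x = 0"
  using dist_0 by auto

lemma edge_dist_cases:
  assumes "u \<in> V" "v \<in> V" "w \<in> V" "d u v = 1"
  shows "d w v = Suc (d w u) \<or> d w u = Suc (d w v)"
  using edge_neq[OF assms] dist_tri[of w u v] dist_tri[of w v u] dist_sym[of u v] assms by auto

lemma edge_side_Un:
  assumes "u \<in> V" "v \<in> V" "d u v = 1"
  shows "edge_side V d u v \<union> edge_side V d v u = V"
  using edge_dist_cases[OF assms(1,2) _ assms(3)] by (force simp: edge_side_def)

lemma edge_side_Int: "edge_side V d u v \<inter> edge_side V d v u = {}"
  by (auto simp: edge_side_def)

lemma dist_across:
  assumes "u \<in> V" "v \<in> V" "d u v = 1" "w \<in> edge_side V d u v" "z \<in> edge_side V d v u"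
  shows "d w z = d w u + 1 + d v z"
  using edge_cut[of u v w z] assms by (auto simp: edge_side_def)

lemma dist_far_end:
  assumes "u \<in> V" "v \<in> V" "d u v = 1" "w \<in> edge_side V d u v"
  shows "d w v = Suc (d w u)"
  using edge_dist_cases[of u v w] assms by (auto simp: edge_side_def)

lemma edge_ends_in_side:
  assumes "u \<in> V" "v \<in> V" "d u v = 1"
  shows "u \<in> edge_side V d u v" "v \<in> edge_side V d v u"
  using assms by (auto simp: edge_side_def dist_self dist_sym)

text \<open>By \<open>dist_across\<close> the distance is \<open>d w u + 1 + d v z\<close>, which is
  1 only if both outer terms vanish.\<close>

lemma crossing_edge_unique:
  assumes "u \<in> V" "v \<in> V" "d u v = 1" "w \<in> edge_side V d u v" "z \<in> edge_side V d v u" "d w z = 1"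
  shows "w = u \<and> z = v"
  using dist_across[OF assms(1-5)] assms dist_0[of w u] dist_0[of v z]
  by (auto simp: edge_side_def)

text \<open>Apart from nonemptiness, only \<open>first_step\<close> needs more than restriction to a
  subset. A first step from \<open>x\<close> towards \<open>y\<close> that leaves the side would
  have to go from \<open>u\<close> to \<open>v\<close>, away from \<open>y\<close>.\<close>

lemma tree_metric_edge_side:
  assumes uv: "u \<in> V" "v \<in> V" "d u v = 1"
  shows "tree_metric (edge_side V d u v) d"
proof -
  let ?A = "edge_side V d u v"
  have AV: "?A \<subseteq> V" by (auto simp: edge_side_def)
  show ?thesis
  proof
    show "finite ?A" using AV finite_V by (rule finite_subset)
    show "?A \<noteq> {}" using edge_ends_in_side[OF uv] by auto
  next
    fix x y assume xy: "x \<in> ?A" "y \<in> ?A" "x \<noteq> y"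
    then obtain w where w: "w \<in> V" "d x w = 1" "d x y = Suc (d w y)"
      using first_step[of x y] AV by auto
    have "w \<in> ?A"
    proof (rule ccontr)
      assume "w \<notin> ?A"
      then have "w \<in> edge_side V d v u" using w edge_side_Un[OF uv] by auto
      with crossing_edge_unique[OF uv xy(1)] w have e: "x = u" "w = v" by auto
      have "d y v = Suc (d y u)" using dist_far_end[OF uv xy(2)] .
      with e w xy AV dist_sym[of y u] dist_sym[of y v] uv show False by auto
    qed
    with w show "\<exists>w\<in>?A. d x w = 1 \<and> d x y = Suc (d w y)" by auto
  next
    show "\<And>x y. x \<in> ?A \<Longrightarrow> y \<in> ?A \<Longrightarrow> d x y = 0 \<longleftrightarrow> x = y" 
      by (rule dist_0[OF subsetD[OF AV] subsetD[OF AV]])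
    show "\<And>x y. x \<in> ?A \<Longrightarrow> y \<in> ?A \<Longrightarrow> d x y = d y x" 
      by (rule dist_sym[OF subsetD[OF AV] subsetD[OF AV]])
    show "\<And>x y z. x \<in> ?A \<Longrightarrow> y \<in> ?A \<Longrightarrow> z \<in> ?A \<Longrightarrow> d x z \<le> d x y + d y z" 
      by (rule dist_tri[OF subsetD[OF AV] subsetD[OF AV] subsetD[OF AV]])
    show "\<And>u v w. u \<in> ?A \<Longrightarrow> v \<in> ?A \<Longrightarrow> w \<in> ?A \<Longrightarrow> d u v = 1 \<Longrightarrow> d w u \<noteq> d w v"
      by (rule edge_neq[OF subsetD[OF AV] subsetD[OF AV] subsetD[OF AV]])
    show "\<And>u v w z. u \<in> ?A \<Longrightarrow> v \<in> ?A \<Longrightarrow> w \<in> ?A \<Longrightarrow> z \<in> ?A \<Longrightarrow> d u v = 1 \<Longrightarrow>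
        d w u < d w v \<Longrightarrow> d z v < d z u \<Longrightarrow> d w z = d w u + 1 + d v z"
      by (rule edge_cut[OF subsetD[OF AV] subsetD[OF AV] subsetD[OF AV] subsetD[OF AV]])
  qed
qed

section \<open>Farthest vertices, leaves and support vertices\<close>

lemma closer_neighbour_unique:
  assumes V: "c \<in> V" "x \<in> V" "w \<in> V" "w' \<in> V"
    and w: "d x w = 1" "d c w < d c x" and w': "d x w' = 1" "d c w' < d c x"
  shows "w = w'"
proof -
  have wx: "d w x = 1" "d w' x = 1" using V w w' dist_sym by auto
  \<comment> \<open>If \<open>w'\<close> lay on the side of \<open>x\<close>, the edge
    \<open>wx\<close> would separate it from \<open>c\<close>, and \<open>d c w'\<close> would be
    \<open>d c x + 1\<close>.\<close>
  have "\<not> d w' x < d w' w"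
  proof
    assume "d w' x < d w' w"
    then have "d c w' = d c w + 1 + d x w'" using edge_cut[of w x c w'] V w wx by auto
    then show False using w w' wx edge_dist_cases[of w x c] V by auto
  qed
  then have "d w' w = 0" using edge_dist_cases[of w x w'] V wx by auto
  then show ?thesis using dist_0 V by auto
qed

text \<open>At a local maximum of the distance from \<open>c\<close> every neighbour is strictly
  closer to \<open>c\<close>, since adjacent vertices are never equidistant from it, and a closer
  neighbour is unique.\<close>

lemma leafI:
  assumes V: "c \<in> V" "x \<in> V" "x \<noteq> c" and max: "\<And>w. w \<in> V \<Longrightarrow> d x w = 1 \<Longrightarrow> d c w \<le> d c x"
  shows "x \<in> metric_leaves V d" "\<exists>w\<in>V. d x w = 1 \<and> Suc (d c w) = d c x \<and> w \<in> metric_supports V d"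
proof -
  obtain w where w: "w \<in> V" "d x w = 1" "d x c = Suc (d w c)"
    using first_step[of x c] V by auto
  have uniq: "w' = w" if "w' \<in> V" "d x w' = 1" for w'
  proof (rule closer_neighbour_unique[OF V(1,2) that(1) w(1) that(2) _ w(2)])
    show "d c w' < d c x"
      using max[OF that] edge_neq[of x w' c] that V by auto
    show "d c w < d c x" using w V dist_sym[of c w] dist_sym[of c x] by auto
  qed
  have "\<exists>!w. w \<in> V \<and> d x w = 1" by (rule ex1I[of _ w]) (use w uniq in blast)+
  then show leaf: "x \<in> metric_leaves V d" using V by (simp add: metric_leaves_def)
  have "w \<in> metric_supports V d" using leaf w V dist_sym[of w x] by (auto simp: metric_supports_def)
  then show "\<exists>w\<in>V. d x w = 1 \<and> Suc (d c w) = d c x \<and> w \<in> metric_supports V d"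
    using w V dist_sym[of c w] dist_sym[of c x] by auto
qed

text \<open>A vertex on the side of \<open>v\<close> farthest from \<open>u\<close> is a leaf by
  \<open>leafI\<close>. Its neighbour is a support vertex, lying on the same side unless it is
  \<open>u\<close>.\<close>

lemma support_behind_edge:
  assumes uv: "u \<in> V" "v \<in> V" "d u v = 1"
  shows "u \<in> metric_supports V d \<or> (\<exists>s \<in> metric_supports V d. s \<in> edge_side V d v u)"
proof -
  let ?B = "edge_side V d v u"
  have fin: "finite ?B" "?B \<noteq> {}" "?B \<subseteq> V" 
    using finite_V edge_ends_in_side[OF uv] by (auto simp: edge_side_def)
  obtain q where q: "q \<in> ?B" and qmax: "\<And>w. w \<in> ?B \<Longrightarrow> d u w \<le> d u q"
    using finite_ex_max[OF fin(1,2), of "d u"] by auto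
  have qV: "q \<in> V" using q by (auto simp: edge_side_def)
  have max: "d u w \<le> d u q" if "w \<in> V" "d q w = 1" for w
  proof (cases "w \<in> ?B")
    case False
    then have "w \<in> edge_side V d u v" using that edge_side_Un[OF uv] by auto
    then have "w = u" using crossing_edge_unique[OF uv _ q, of w] that dist_sym[of q w] qV by auto
    then show ?thesis using uv dist_self by auto
  qed (use qmax in auto)
  have "q \<noteq> u" using q uv dist_self by (auto simp: edge_side_def)
  then obtain w where w: "w \<in> V" "d q w = 1" "w \<in> metric_supports V d"
    using leafI(2)[of u q] uv qV max by auto
  show ?thesis
  proof (cases "w \<in> ?B")
    case False
    then have "w \<in> edge_side V d u v" using w edge_side_Un[OF uv] by auto
    then have "w = u" using crossing_edge_unique[OF uv _ q, of w] w dist_sym[of q w] qV by auto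
    then show ?thesis using w by auto
  qed (use w in auto)
qed

text \<open>A vertex farthest from \<open>c\<close>, unless it is \<open>c\<close>, is a leaf whose
  support vertex is one step closer.\<close>

lemma eccentricity_le_if_supports_close:
  assumes c: "c \<in> V" and S: "\<And>s. s \<in> metric_supports V d \<Longrightarrow> d c s \<le> k" and w: "w \<in> V"
  shows "d c w \<le> Suc k"
proof -
  obtain q where q: "q \<in> V" and qmax: "\<And>w. w \<in> V \<Longrightarrow> d c w \<le> d c q"
    using finite_ex_max[OF finite_V V_nonempty, of "d c"] by auto
  have "d c q \<le> Suc k"
  proof (cases "q = c")
    case False
    then obtain s where "Suc (d c s) = d c q" "s \<in> metric_supports V d"
      using leafI(2)[of c q] c q qmax by auto
    then show ?thesis using S by fastforce
  qed (use c dist_self in auto)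
  then show ?thesis using qmax[OF w] by simp
qed

section \<open>Shortest paths and projections onto them\<close>

lemma geodesic:
  assumes "x \<in> V" "y \<in> V" "d x y = D"
  obtains p where "p 0 = x" "p D = y" "\<And>i. i \<le> D \<Longrightarrow> p i \<in> V"
    "\<And>i j. i \<le> j \<Longrightarrow> j \<le> D \<Longrightarrow> d (p i) (p j) = j - i"
proof -
  have "\<exists>p. p 0 = x \<and> p D = y \<and> (\<forall>i\<le>D. p i \<in> V) \<and> (\<forall>i j. i \<le> j \<longrightarrow> j \<le> D \<longrightarrow> d (p i) (p j) = j - i)"
    using assms
  proof (induction D arbitrary: x)
    case 0
    then show ?case using dist_0 by (intro exI[of _ "\<lambda>_. x"]) auto
  next
    case (Suc D)
    then have "x \<noteq> y" using dist_self by auto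
    then obtain w where w: "w \<in> V" "d x w = 1" "d w y = D" using first_step[of x y] Suc.prems by auto
    with Suc obtain p where p: "p 0 = w" "p D = y" "\<forall>i\<le>D. p i \<in> V"
      "\<forall>i j. i \<le> j \<longrightarrow> j \<le> D \<longrightarrow> d (p i) (p j) = j - i" by blast
    let ?p = "\<lambda>i. case i of 0 \<Rightarrow> x | Suc i \<Rightarrow> p i"
    \<comment> \<open>The upper bound goes through \<open>w\<close>. The lower bound compares with
      \<open>y\<close>: a shorter way to \<open>p j\<close> would shorten the distance from
      \<open>x\<close> to \<open>y\<close>.\<close>
    have x: "d x (p j) = Suc j" if j: "j \<le> D" for j
    proof -
      have "d w (p j) = j" using p(1) p(4)[rule_format, of 0 j] j by simp
      moreover have "d (p j) y = D - j" using p(2) p(4)[rule_format, of j D] j by simp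
      moreover have "p j \<in> V" using p j by simp
      ultimately show ?thesis using dist_tri[of x w "p j"] dist_tri[of x "p j" y] Suc.prems w j by simp
    qed
    have "\<forall>i j. i \<le> j \<longrightarrow> j \<le> Suc D \<longrightarrow> d (?p i) (?p j) = j - i"
      using x p dist_self Suc.prems by (auto split: nat.split)
    then show ?case using p Suc.prems by (intro exI[of _ ?p]) (auto split: nat.split)
  qed
  then show ?thesis using that by blast
qed

text \<open>Let \<open>p i\<close> be a point of the path nearest to \<open>z\<close>. A path edge
  leaving \<open>p i\<close> in either direction separates \<open>z\<close> from the rest of the
  path in that direction, so \<open>edge_cut\<close> makes the distances add up.\<close>

lemma projection_on_geodesic:
  assumes pV: "\<And>i. i \<le> D \<Longrightarrow> p i \<in> V" and pd: "\<And>i j. i \<le> j \<Longrightarrow> j \<le> D \<Longrightarrow> d (p i) (p j) = j - i"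
    and z: "z \<in> V"
  obtains i where "i \<le> D" "\<And>k. i \<le> k \<Longrightarrow> k \<le> D \<Longrightarrow> d z (p k) = d z (p i) + (k - i)"
    "\<And>k. k \<le> i \<Longrightarrow> d z (p k) = d z (p i) + (i - k)"
proof -
  define i where "i = arg_min_on (\<lambda>i. d z (p i)) {..D}"
  have i: "i \<le> D" and imin: "\<And>k. k \<le> D \<Longrightarrow> d z (p i) \<le> d z (p k)"
    using arg_min_if_finite[of "{..D}" "\<lambda>i. d z (p i)"]
    unfolding i_def by (auto simp: not_less)
  have up: "d z (p k) = d z (p i) + (k - i)" if k: "i \<le> k" "k \<le> D" for k
  proof (cases "i = k")
    case False
    then have ik: "Suc i \<le> k" using k by simp
    have V: "p i \<in> V" "p (Suc i) \<in> V" "p k \<in> V" using pV ik k by auto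
    have e: "d (p i) (p (Suc i)) = 1" using pd[of i "Suc i"] ik k by simp
    have f: "d (p (Suc i)) (p k) = k - Suc i" "d (p i) (p k) = k - i" using pd ik k by auto
    have "d z (p i) < d z (p (Suc i))"
      using edge_neq[OF V(1,2) z e] imin[of "Suc i"] ik k by auto
    then have "d z (p k) = d z (p i) + 1 + d (p (Suc i)) (p k)"
      using V f ik by (intro edge_cut[OF V(1,2) z V(3) e]) (auto simp: dist_sym)
    then show ?thesis using f ik by simp
  qed simp
  have down: "d z (p k) = d z (p i) + (i - k)" if k: "k \<le> i" for k
  proof (cases "i = k")
    case False
    then obtain m where m: "i = Suc m" "k \<le> m" using k by (cases i) auto
    have V: "p i \<in> V" "p m \<in> V" "p k \<in> V" using pV m i by auto
    have e: "d (p i) (p m) = 1" using pd[of m i] m i V dist_sym[of "p i" "p m"] by simp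
    have f: "d (p m) (p k) = m - k" "d (p i) (p k) = i - k"
      using pd[of k m] pd[of k i] m i V by (auto simp: dist_sym)
    have "d z (p i) < d z (p m)"
      using edge_neq[OF V(1,2) z e] imin[of m] m i by auto
    then have "d z (p k) = d z (p i) + 1 + d (p m) (p k)"
      using V f m by (intro edge_cut[OF V(1,2) z V(3) e]) (auto simp: dist_sym)
    then show ?thesis using f m by simp
  qed simp
  show ?thesis using that i up down by blast
qed

end

section \<open>Lower bound\<close>

context tree_metric
begin

section \<open>Leaves and support vertices of one side of an edge\<close>

lemma neighbour_in_edge_side:
  assumes uv: "u \<in> V" "v \<in> V" "d u v = 1"
    and "w \<in> edge_side V d u v" "w \<noteq> u" "z \<in> V" "d w z = 1"
  shows "z \<in> edge_side V d u v"
  using crossing_edge_unique[OF uv, of w z] edge_side_Un[OF uv] assms by auto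

text \<open>Only \<open>u\<close> loses a neighbour when the edge is cut.\<close>

lemma leaf_edge_side_iff:
  assumes uv: "u \<in> V" "v \<in> V" "d u v = 1"
    and w: "w \<in> edge_side V d u v" "w \<noteq> u"
  shows "w \<in> metric_leaves (edge_side V d u v) d \<longleftrightarrow> w \<in> metric_leaves V d"
proof -
  have sub: "edge_side V d u v \<subseteq> V" by (auto simp: edge_side_def)
  have "(\<lambda>z. z \<in> edge_side V d u v \<and> d w z = 1) = (\<lambda>z. z \<in> V \<and> d w z = 1)"
    using neighbour_in_edge_side[OF uv w] sub by (intro ext) blast
  then show ?thesis using w sub by (auto simp: metric_leaves_def)
qed

lemma leaf_neighbours:
  assumes "u \<in> metric_leaves V d"
  obtains u' where "u' \<in> V" "d u u' = 1" "\<And>z. z \<in> V \<Longrightarrow> d u z = 1 \<Longrightarrow> z = u'"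
proof -
  have "\<exists>!w. w \<in> V \<and> d u w = 1" using assms by (simp add: metric_leaves_def)
  then show ?thesis using that by (elim ex1E) blast
qed

text \<open>A new support vertex needs a new leaf next to it, and only \<open>u\<close> can become a
  leaf.\<close>

lemma supports_edge_side_cases:
  assumes uv: "u \<in> V" "v \<in> V" "d u v = 1"
    and w: "w \<in> metric_supports (edge_side V d u v) d" "w \<notin> metric_supports V d"
  shows "u \<in> metric_leaves (edge_side V d u v) d \<and> d u w = 1"
proof -
  let ?A = "edge_side V d u v"
  have sub: "?A \<subseteq> V" by (auto simp: edge_side_def)
  obtain l where l: "w \<in> ?A" "l \<in> metric_leaves ?A d" "d w l = 1"
    using w by (auto simp: metric_supports_def)
  then have lA: "l \<in> ?A" by (simp add: metric_leaves_def)
  have "l = u"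
  proof (rule ccontr)
    assume "l \<noteq> u"
    then have "l \<in> metric_leaves V d" using leaf_edge_side_iff[OF uv lA] l by simp
    then have "w \<in> metric_supports V d" using l sub by (auto simp: metric_supports_def)
    then show False using w by simp
  qed
  then show ?thesis using l sub dist_sym[of w u] uv by auto
qed

text \<open>The side can gain only \<open>u\<close> as a leaf and only the remaining neighbour
  \<open>u'\<close> of \<open>u\<close> as a support vertex. The second claim extracts from a gain
  of exactly 2 what the equality case of the lower bound needs.\<close>

lemma count_edge_side:
  assumes uv: "u \<in> V" "v \<in> V" "d u v = 1"
  defines "A \<equiv> edge_side V d u v"
  shows "card (metric_leaves A d) + card (metric_supports A d)
      \<le> card (metric_leaves V d \<inter> A) + card (metric_supports V d \<inter> A) + 2" (is ?le)
    and "card (metric_leaves A d) + card (metric_supports A d)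
      = card (metric_leaves V d \<inter> A) + card (metric_supports V d \<inter> A) + 2 \<Longrightarrow>
      \<exists>u'\<in>A. d u u' = 1 \<and> u \<in> metric_leaves A d \<and> u' \<notin> metric_supports V d \<and>
        metric_supports A d = insert u' (metric_supports V d \<inter> A)" (is "?eq \<Longrightarrow> ?ex")
proof -
  interpret A: tree_metric A d unfolding A_def by (rule tree_metric_edge_side[OF uv])
  have fin: "finite (metric_leaves V d \<inter> A)" "finite (metric_supports V d \<inter> A)"
    using finite_leaves finite_supports by auto
  have "?le \<and> (?eq \<longrightarrow> ?ex)"
  proof (cases "u \<in> metric_leaves A d")
    \<comment> \<open>If \<open>u\<close> is not a leaf of its side, neither count can grow.\<close>
    case False
    have "metric_leaves A d \<subseteq> metric_leaves V d \<inter> A"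
      using False leaf_edge_side_iff[OF uv] A.leaves_subset unfolding A_def by blast
    moreover have "metric_supports A d \<subseteq> metric_supports V d \<inter> A"
      using False supports_edge_side_cases[OF uv] A.supports_subset unfolding A_def by blast
    ultimately have "card (metric_leaves A d) \<le> card (metric_leaves V d \<inter> A)"
        "card (metric_supports A d) \<le> card (metric_supports V d \<inter> A)"
      by (blast intro: card_mono fin)+
    then show ?thesis by linarith
  next
    case True
    obtain u' where u': "u' \<in> A" "d u u' = 1" "\<And>z. z \<in> A \<Longrightarrow> d u z = 1 \<Longrightarrow> z = u'"
      using A.leaf_neighbours[OF True] by blast
    have L: "metric_leaves A d \<subseteq> insert u (metric_leaves V d \<inter> A)"
      using leaf_edge_side_iff[OF uv] A.leaves_subset unfolding A_def by blast
    have S: "metric_supports A d \<subseteq> insert u' (metric_supports V d \<inter> A)"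
      using supports_edge_side_cases[OF uv] A.supports_subset u'(3) unfolding A_def by blast
    have cL: "card (metric_leaves A d) \<le> card (metric_leaves V d \<inter> A) + 1"
      using card_mono[OF _ L] fin
      by (auto simp: card_insert_if split: if_splits)
    have cS1: "card (insert u' (metric_supports V d \<inter> A)) \<le> card (metric_supports V d \<inter> A) + 1"
      using fin by (auto simp: card_insert_if)
    have cS: "card (metric_supports A d) \<le> card (insert u' (metric_supports V d \<inter> A))"
      using card_mono[OF _ S] fin by simp
    have ?le using cL cS cS1 by linarith
    moreover have ?ex if ?eq
    proof -
      have "card (insert u' (metric_supports V d \<inter> A)) \<le> card (metric_supports A d)"
        using cL cS cS1 that by linarith
      then have SA: "metric_supports A d = insert u' (metric_supports V d \<inter> A)"
        using card_seteq[OF _ S] fin by simp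
      moreover have "u' \<notin> metric_supports V d"
      proof
        assume "u' \<in> metric_supports V d"
        then have "metric_supports A d = metric_supports V d \<inter> A"
          unfolding SA using u'(1) by (intro insert_absorb) simp
        then have "card (metric_supports A d) = card (metric_supports V d \<inter> A)" by (rule arg_cong)
        then show False using cL that by linarith
      qed
      ultimately show ?thesis using True u' by blast
    qed
    ultimately show ?thesis by blast
  qed
  then show ?le "?eq \<Longrightarrow> ?ex" by blast+
qed

text \<open>The leaf \<open>u\<close> is reached only through the support vertex \<open>u'\<close>,
  which gives \<open>2 + 1\<close>. This is applied to a side of a cut, with \<open>u\<close> the
  end of the cut edge.\<close>

lemma support_dist_cut_end:
  assumes leaf: "u \<in> metric_leaves V d" "u' \<in> V" "d u u' = 1"
    and good: "supports_2_mod_5 V d" and z: "z \<in> metric_supports V d" "z \<noteq> u'"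
  shows "d z u mod 5 = 3"
proof -
  have uV: "u \<in> V" using leaf by (simp add: metric_leaves_def)
  have u'S: "u' \<in> metric_supports V d"
    using leaf uV dist_sym[of u u'] by (auto simp: metric_supports_def)
  have zV: "z \<in> V" using z supports_subset by auto
  have zu': "d z u' mod 5 = 2" using good z u'S by (auto simp: supports_2_mod_5_def)
  then have "z \<noteq> u" using leaf by auto
  then obtain w where w: "w \<in> V" "d u w = 1" "d u z = Suc (d w z)"
    using first_step[OF uV zV] by auto
  then have "w = u'" using leaf_neighbours[OF leaf(1)] leaf by metis
  then have "d z u = Suc (d z u')" using w dist_sym[OF zV uV] dist_sym[OF zV w(1)] by simp
  then show ?thesis using zu' by (simp add: mod_Suc)
qed

lemma card_edge_sides:
  assumes uv: "u \<in> V" "v \<in> V" "d u v = 1" and B: "B \<subseteq> V"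
  shows "card (B \<inter> edge_side V d u v) + card (B \<inter> edge_side V d v u) = card B"
proof -
  have "finite B" using B finite_V by (rule finite_subset)
  then have "card (B \<inter> edge_side V d u v) + card (B \<inter> edge_side V d v u)
      = card ((B \<inter> edge_side V d u v) \<union> (B \<inter> edge_side V d v u))"
    using edge_side_Int by (intro card_Un_disjoint[symmetric]) auto
  also have "(B \<inter> edge_side V d u v) \<union> (B \<inter> edge_side V d v u) = B"
    using edge_side_Un[OF uv] B by auto
  finally show ?thesis .
qed

text \<open>A dominating vertex \<open>z\<close> beyond the edge can be replaced by
  \<open>x\<close>, which is no farther from \<open>u\<close> than \<open>z\<close> is.\<close>

lemma dominating_edge_side:
  assumes uv: "u \<in> V" "v \<in> V" "d u v = 1" and X: "X \<subseteq> V" "\<And>w. w \<in> V \<Longrightarrow> \<exists>x\<in>X. d w x \<le> k"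
    and x: "x \<in> X \<inter> edge_side V d u v" "\<And>z. z \<in> X \<inter> edge_side V d v u \<Longrightarrow> d u x \<le> Suc (d v z)"
    and w: "w \<in> edge_side V d u v"
  shows "\<exists>x\<in>X \<inter> edge_side V d u v. d w x \<le> k"
proof -
  have wV: "w \<in> V" using w by (simp add: edge_side_def)
  obtain z where z: "z \<in> X" "d w z \<le> k" using X(2)[OF wV] by auto
  show ?thesis
  proof (cases "z \<in> edge_side V d u v")
    case False
    then have zB: "z \<in> edge_side V d v u" using z X edge_side_Un[OF uv] by auto
    have "d w x \<le> d w u + d u x" using dist_tri wV uv x X by auto
    also have "\<dots> \<le> d w z" using x(2)[of z] z zB dist_across[OF uv w zB] by simp
    finally show ?thesis using x(1) z(2) by (intro bexI[of _ x]) auto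
  qed (use z in auto)
qed

text \<open>Vertices at distance 2 from \<open>c\<close> are leaves, and those at distance 1 are
  leaves or support vertices, so only \<open>c\<close> can be left over. Equality makes the two sets
  disjoint and keeps \<open>c\<close> out of both; then all support vertices are neighbours of
  \<open>c\<close>.\<close>

lemma bound_radius_2:
  assumes c: "c \<in> V" and r: "\<And>w. w \<in> V \<Longrightarrow> d w c \<le> 2"
  shows "card V \<le> 1 + card (metric_leaves V d) + card (metric_supports V d)"
    and "card V = 1 + card (metric_leaves V d) + card (metric_supports V d) \<Longrightarrow> supports_2_mod_5 V d"
proof -
  let ?L = "metric_leaves V d" and ?S = "metric_supports V d"
  have r': "d c w \<le> 2" if "w \<in> V" for w using r[OF that] dist_sym[OF c that] by simp
  have far: "w \<in> ?L" if "w \<in> V" "d c w = 2" for w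
  proof (rule leafI(1)[OF c])
    show "w \<noteq> c" using that c dist_self by auto
  qed (use that r' in auto)
  have near: "w \<in> ?L \<union> ?S" if w: "w \<in> V" "d c w = 1" for w
  proof (cases "\<exists>z\<in>V. d w z = 1 \<and> d c z = 2")
    case True
    then show ?thesis using far w by (auto simp: metric_supports_def)
  next
    case False
    have "w \<in> ?L"
    proof (rule leafI(1)[OF c w(1)])
      show "w \<noteq> c" using w c dist_self by auto
      fix z assume "z \<in> V" "d w z = 1"
      then show "d c z \<le> d c w" using False r'[of z] w by fastforce
    qed
    then show ?thesis by simp
  qed
  have cover: "V \<subseteq> insert c (?L \<union> ?S)"
  proof
    fix w assume w: "w \<in> V"
    consider "d c w = 0" | "d c w = 1" | "d c w = 2" using r'[OF w] by linarith
    then show "w \<in> insert c (?L \<union> ?S)"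
      by cases (use near far w c dist_0 in auto)
  qed
  have fin: "finite ?L" "finite ?S" using finite_leaves finite_supports by auto
  have le1: "card V \<le> card (insert c (?L \<union> ?S))" using cover fin by (intro card_mono) auto
  have le2: "card (insert c (?L \<union> ?S)) \<le> 1 + card (?L \<union> ?S)" using fin by (simp add: card_insert_if)
  have un: "card (?L \<union> ?S) + card (?L \<inter> ?S) = card ?L + card ?S"
    using card_Un_Int[OF fin] by simp
  show "card V \<le> 1 + card ?L + card ?S" using le1 le2 un by linarith
  assume eq: "card V = 1 + card ?L + card ?S"
  then have "card (?L \<inter> ?S) = 0" and ins: "card (insert c (?L \<union> ?S)) = 1 + card (?L \<union> ?S)"
    using le1 le2 un by linarith+
  then have disj: "?L \<inter> ?S = {}" using fin by simp
  have cn: "c \<notin> ?L \<union> ?S" using ins fin by (auto simp: card_insert_if split: if_splits)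
  have S1: "d c s = 1" if s: "s \<in> ?S" for s
  proof -
    have sV: "s \<in> V" using s supports_subset by auto
    have "d c s \<noteq> 0" using dist_0[OF c sV] s cn by auto
    moreover have "d c s \<noteq> 2" using far[OF sV] s disj by auto
    ultimately show ?thesis using r'[OF sV] by linarith
  qed
  show "supports_2_mod_5 V d"
    unfolding supports_2_mod_5_def
  proof (intro ballI impI)
    fix x y assume xy: "x \<in> ?S" "y \<in> ?S" "x \<noteq> y"
    have V: "x \<in> V" "y \<in> V" using xy supports_subset by auto
    have yc: "d y c = 1" "d x c = 1" using S1 xy V c dist_sym by auto
    \<comment> \<open>Along the edge \<open>cy\<close> the distance from \<open>x\<close> changes by
      exactly one from \<open>d x c = 1\<close>, so \<open>d x y\<close> is 2 or 0.\<close>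
    have "d x y = Suc (d x c) \<or> d x c = Suc (d x y)" using edge_dist_cases[OF c V(2,1)] S1[OF xy(2)] by simp
    moreover have "d x y \<noteq> 0" using dist_0 V xy by auto
    ultimately show "d x y mod 5 = 2" using yc by auto
  qed
qed

end

text \<open>Adding the bounds for the two parts of a cut yields \<open>card V + 8\<close> on the
  left, and the at most 4 new leaves and support vertices on the right pay for the surplus. The
  equality clause belongs to the same induction, because equality for the tree needs it for both
  parts.\<close>

theorem domination_lower_bound:
  assumes "tree_metric V d" "X \<subseteq> V" "\<And>w. w \<in> V \<Longrightarrow> \<exists>x\<in>X. d w x \<le> 2"
  shows "card V + 4 \<le> 5 * card X + card (metric_leaves V d) + card (metric_supports V d) \<and>
    (card V + 4 = 5 * card X + card (metric_leaves V d) + card (metric_supports V d) \<longrightarrow>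
      supports_2_mod_5 V d)"
  using assms
proof (induction "card X" arbitrary: X V rule: less_induct)
  case less
  interpret tree_metric V d by fact
  note X = less.prems(2,3)
  have finX: "finite X" using X finite_V finite_subset by auto
  have X0: "X \<noteq> {}" using V_nonempty X by auto
  let ?L = "metric_leaves V d" and ?S = "metric_supports V d"
  show ?case
  proof (cases "\<exists>c. X = {c}")
    case True
    then obtain c where c: "X = {c}" by auto
    then show ?thesis using bound_radius_2[of c] X by auto
  next
    case False
    define P where "P = {(x, y). x \<in> X \<and> y \<in> X \<and> x \<noteq> y}"
    have "P \<noteq> {}" using X0 False unfolding P_def by auto
    moreover have "finite P"
      by (rule finite_subset[of _ "X \<times> X"]) (use finX in \<open>auto simp: P_def\<close>)
    ultimately obtain q where q: "q \<in> P" "\<And>r. r \<in> P \<Longrightarrow> d (fst q) (snd q) \<le> d (fst r) (snd r)"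
      using arg_min_if_finite[of P "\<lambda>r. d (fst r) (snd r)"] by (metis not_less)
    obtain x y where "q = (x, y)" by force
    with q have xy: "x \<in> X" "y \<in> X" "x \<noteq> y"
      and min: "\<And>a b. a \<in> X \<Longrightarrow> b \<in> X \<Longrightarrow> a \<noteq> b \<Longrightarrow> d x y \<le> d a b"
      unfolding P_def by force+
    have xyV: "x \<in> V" "y \<in> V" using xy X by auto
    define D where "D = d x y"
    have D: "D > 0" using dist_0[OF xyV] xy D_def by auto
    obtain p where p: "p 0 = x" "p D = y" "\<And>i. i \<le> D \<Longrightarrow> p i \<in> V"
      "\<And>i j. i \<le> j \<Longrightarrow> j \<le> D \<Longrightarrow> d (p i) (p j) = j - i"
      using geodesic[OF xyV D_def[symmetric]] by blast
    \<comment> \<open>The rounding makes \<open>d v y\<close> equal to \<open>i\<close> or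
      \<open>i + 1\<close>, where \<open>i = d x u\<close>.\<close>
    define i where "i = (D - 1) div 2"
    have i: "Suc i \<le> D" "D \<le> 2 * i + 2" "2 * i + 1 \<le> D" using D by (auto simp: i_def)
    define u v where "u = p i" and "v = p (Suc i)"
    have uv: "u \<in> V" "v \<in> V" "d u v = 1" using p(3)[of i] p(3)[of "Suc i"] p(4)[of i "Suc i"] i
      by (auto simp: u_def v_def)
    have vu: "d v u = 1" using uv dist_sym by simp
    have dx: "d x u = i" "d x v = Suc i" and dy: "d u y = D - i" "d v y = D - Suc i"
      using p(1,2) p(4)[of 0 i] p(4)[of 0 "Suc i"] p(4)[of i D] p(4)[of "Suc i" D] i
      by (auto simp: u_def v_def)
    let ?A = "edge_side V d u v" and ?B = "edge_side V d v u"
    have xA: "x \<in> X \<inter> ?A" using xy xyV dx by (simp add: edge_side_def)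
    have yB: "y \<in> X \<inter> ?B" using xy xyV dy i dist_sym[OF xyV(2)] uv by (simp add: edge_side_def)
    have domA: "\<exists>x\<in>X \<inter> ?A. d w x \<le> 2" if "w \<in> ?A" for w
    proof (rule dominating_edge_side[OF uv X xA _ that])
      fix z assume z: "z \<in> X \<inter> ?B"
      then have "x \<noteq> z" using xA edge_side_Int by auto
      \<comment> \<open>Since \<open>x\<close>, \<open>y\<close> are closest in \<open>X\<close>,
        \<open>i + 1 + d v z \<ge> D \<ge> 2 * i + 1\<close>, hence
        \<open>d v z \<ge> i\<close>.\<close>
      then have "D \<le> d x z" using min z xy D_def by auto
      moreover have "d x z = d x u + 1 + d v z" using dist_across[OF uv] xA z by auto
      ultimately show "d u x \<le> Suc (d v z)" using dx i dist_sym[OF xyV(1) uv(1)] by simp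
    qed
    have domB: "\<exists>x\<in>X \<inter> ?B. d w x \<le> 2" if "w \<in> ?B" for w
    proof (rule dominating_edge_side[OF uv(2,1) vu X yB _ that])
      fix z assume z: "z \<in> X \<inter> ?A"
      then have "z \<noteq> y" using yB edge_side_Int by auto
      then have "D \<le> d z y" using min z xy D_def by auto
      moreover have "d z y = d z u + 1 + d v y" using dist_across[OF uv] yB z by auto
      moreover have "d z u = d u z" using dist_sym z X uv by auto
      ultimately show "d v y \<le> Suc (d u z)" using dy i by simp
    qed
    have cX: "card (X \<inter> ?A) + card (X \<inter> ?B) = card X" using card_edge_sides[OF uv X(1)] .
    have "card (X \<inter> ?A) > 0" "card (X \<inter> ?B) > 0" using xA yB finX by (auto simp: card_gt_0_iff)
    then have less: "card (X \<inter> ?A) < card X" "card (X \<inter> ?B) < card X" using cX by linarith+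
    have tA: "tree_metric ?A d" and tB: "tree_metric ?B d"
      using tree_metric_edge_side uv vu by auto
    interpret A: tree_metric ?A d by fact
    interpret B: tree_metric ?B d by fact
    note IA = less.hyps[OF less(1) tA _ domA, simplified]
    note IB = less.hyps[OF less(2) tB _ domB, simplified]
    have cV: "card ?A + card ?B = card V"
      using card_edge_sides[OF uv, of V] by (simp add: edge_side_def Int_def)
    have cL: "card (?L \<inter> ?A) + card (?L \<inter> ?B) = card ?L" using card_edge_sides[OF uv leaves_subset] .
    have cS: "card (?S \<inter> ?A) + card (?S \<inter> ?B) = card ?S" using card_edge_sides[OF uv supports_subset] .
    note kA = count_edge_side[OF uv] and kB = count_edge_side[OF uv(2,1) vu]
    have "card V + 4 \<le> 5 * card X + card ?L + card ?S"
      using IA IB cV cX cL cS kA(1) kB(1) by linarith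
    moreover have "supports_2_mod_5 V d" if eq: "card V + 4 = 5 * card X + card ?L + card ?S"
    proof -
      \<comment> \<open>Equality leaves no slack in the two induction bounds or in the two counting
        bounds, so all four are equalities.\<close>
      have gA: "supports_2_mod_5 ?A d" and gB: "supports_2_mod_5 ?B d"
        using IA IB cV cX cL cS kA(1) kB(1) eq by linarith+
      have "card (metric_leaves ?A d) + card (metric_supports ?A d)
          = card (?L \<inter> ?A) + card (?S \<inter> ?A) + 2"
        using IA IB cV cX cL cS kA(1) kB(1) eq by linarith
      then obtain u' where u': "u' \<in> ?A" "d u u' = 1" "u \<in> metric_leaves ?A d" "u' \<notin> ?S"
        "metric_supports ?A d = insert u' (?S \<inter> ?A)" using kA(2) by blast
      have "card (metric_leaves ?B d) + card (metric_supports ?B d)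
          = card (?L \<inter> ?B) + card (?S \<inter> ?B) + 2"
        using IA IB cV cX cL cS kA(1) kB(1) eq by linarith
      then obtain v' where v': "v' \<in> ?B" "d v v' = 1" "v \<in> metric_leaves ?B d" "v' \<notin> ?S"
        "metric_supports ?B d = insert v' (?S \<inter> ?B)" using kB(2) by blast
      have du: "d z u mod 5 = 3" if "z \<in> ?S \<inter> ?A" for z
        using A.support_dist_cut_end[OF u'(3,1,2) gA, of z] that u'(4,5) by auto
      have dv: "d z v mod 5 = 3" if "z \<in> ?S \<inter> ?B" for z
        using B.support_dist_cut_end[OF v'(3,1,2) gB, of z] that v'(4,5) by auto
      have across: "d a b mod 5 = 2 \<and> d b a mod 5 = 2" if ab: "a \<in> ?S \<inter> ?A" "b \<in> ?S \<inter> ?B" for a b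
      proof -
        have V: "a \<in> V" "b \<in> V" using ab supports_subset by auto
        have "d a b = d a u + 1 + d b v"
          using dist_across[OF uv, of a b] ab dist_sym[OF V(2) uv(2)] by simp
        then have "d a b mod 5 = 2" using du[OF ab(1)] dv[OF ab(2)] by presburger
        then show ?thesis using dist_sym[OF V] by simp
      qed
      show ?thesis unfolding supports_2_mod_5_def
      proof (intro ballI impI)
        fix a b assume ab: "a \<in> ?S" "b \<in> ?S" "a \<noteq> b"
        have "a \<in> ?A \<or> a \<in> ?B" "b \<in> ?A \<or> b \<in> ?B"
          using ab supports_subset edge_side_Un[OF uv] by auto
        then consider "a \<in> ?A" "b \<in> ?A" | "a \<in> ?B" "b \<in> ?B" | "a \<in> ?A" "b \<in> ?B"
          | "a \<in> ?B" "b \<in> ?A" by blast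
        then show "d a b mod 5 = 2"
        proof cases
          case 1
          then show ?thesis using gA ab u'(5) by (simp add: supports_2_mod_5_def)
        next
          case 2
          then show ?thesis using gB ab v'(5) by (simp add: supports_2_mod_5_def)
        qed (use across ab in auto)
      qed
    qed
    ultimately show ?thesis by blast
  qed
qed

section \<open>Upper bound\<close>

text \<open>Here \<open>h\<close> is the distance from a vertex to its projection, at position
  \<open>i\<close> on a path of length \<open>D\<close>. Adding the first two congruences gives
  \<open>2 * h + D = 4\<close> modulo 5, and 2 is invertible modulo 5.\<close>

lemma mod_5_projection:
  fixes h i D :: nat
  assumes "(h + i) mod 5 = 2" "(h + (D - i)) mod 5 = 2" "D mod 5 = 2" "i \<le> D"
  shows "i mod 5 = 1" "h mod 5 = 1"
proof -
  have "(h + i + (h + (D - i))) mod 5 = (2 + 2) mod 5"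
    by (rule mod_add_cong) (use assms in auto)
  then have "(2 * h + D) mod 5 = 4" using assms(4) by (simp add: mult_2 add.commute add.left_commute)
  then show h: "h mod 5 = 1" using assms(3) by presburger
  then show "i mod 5 = 1" using assms(1) by presburger
qed

context tree_metric
begin

text \<open>The cut turns \<open>u\<close>, with neighbours \<open>u'\<close> and \<open>v\<close>
  only, into a leaf and \<open>u'\<close> into a support vertex: the maximal gain in
  \<open>count_edge_side\<close>. As \<open>u\<close> is no support vertex, the old support vertices
  keep their leaves. Hypothesis \<open>u'S\<close> supplies the distance condition for
  \<open>u'\<close>.\<close>

lemma edge_side_of_degree_2_edge:
  assumes uv: "u \<in> V" "v \<in> V" "d u v = 1"
  defines "A \<equiv> edge_side V d u v"
  assumes u': "u' \<in> A" "d u u' = 1" and deg: "\<And>z. z \<in> V \<Longrightarrow> d u z = 1 \<Longrightarrow> z = u' \<or> z = v"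
    and notS: "u \<notin> metric_supports V d" "u' \<notin> metric_supports V d"
    and good: "supports_2_mod_5 V d"
    and u'S: "\<And>z. z \<in> metric_supports V d \<inter> A \<Longrightarrow> d z u' mod 5 = 2"
  shows "card (metric_leaves A d) = card (metric_leaves V d \<inter> A) + 1"
    and "metric_supports A d = insert u' (metric_supports V d \<inter> A)"
    and "card (metric_supports A d) = card (metric_supports V d \<inter> A) + 1"
    and "supports_2_mod_5 A d"
proof -
  interpret A: tree_metric A d unfolding A_def by (rule tree_metric_edge_side[OF uv])
  have sub: "A \<subseteq> V" by (auto simp: A_def edge_side_def)
  have uA: "u \<in> A" unfolding A_def using edge_ends_in_side[OF uv] by simp
  have vA: "v \<notin> A" unfolding A_def using edge_ends_in_side[OF uv] edge_side_Int by auto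
  have u'V: "u' \<in> V" using u' sub by auto
  have fin: "finite (metric_leaves V d \<inter> A)" "finite (metric_supports V d \<inter> A)"
    using finite_leaves finite_supports by auto
  have "\<exists>!w. w \<in> A \<and> d u w = 1"
  proof (rule ex1I[of _ u'])
    fix w assume "w \<in> A \<and> d u w = 1"
    then show "w = u'" using deg[of w] sub vA by blast
  qed (use u' in auto)
  then have uL: "u \<in> metric_leaves A d" using uA by (simp add: metric_leaves_def)
  have u_notL: "u \<notin> metric_leaves V d"
  proof
    assume "u \<in> metric_leaves V d"
    then have "u' = v" using leaf_neighbours[of u] uv u' u'V by metis
    then show False using vA u' by simp
  qed
  have L: "metric_leaves A d = insert u (metric_leaves V d \<inter> A)"
    using leaf_edge_side_iff[OF uv] A.leaves_subset uL unfolding A_def by blast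
  then show "card (metric_leaves A d) = card (metric_leaves V d \<inter> A) + 1"
    using u_notL fin by simp
  have "d u' u = 1" using dist_sym[OF uv(1) u'V] u' by simp
  then have u'SA: "u' \<in> metric_supports A d" using uL u' by (auto simp: metric_supports_def)
  have "w \<in> metric_supports A d" if w: "w \<in> metric_supports V d" "w \<in> A" for w
  proof -
    obtain l where l: "l \<in> metric_leaves V d" "d w l = 1"
      using w by (auto simp: metric_supports_def)
    have "l \<in> A" unfolding A_def
      by (rule neighbour_in_edge_side[OF uv, of w]) (use w l notS leaves_subset A_def in auto)
    then have "l \<in> metric_leaves A d" using L l by simp
    then show ?thesis using w l by (auto simp: metric_supports_def)
  qed
  moreover have "w = u'" if "w \<in> metric_supports A d" "w \<notin> metric_supports V d" for w
  proof -
    have "w \<in> A" using that A.supports_subset by auto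
    moreover have "d u w = 1" using supports_edge_side_cases[OF uv] that unfolding A_def by blast
    ultimately show ?thesis using deg[of w] sub vA by blast
  qed
  ultimately show S: "metric_supports A d = insert u' (metric_supports V d \<inter> A)"
    using u'SA A.supports_subset by blast
  then show "card (metric_supports A d) = card (metric_supports V d \<inter> A) + 1"
    using notS fin by simp
  show "supports_2_mod_5 A d" unfolding supports_2_mod_5_def
  proof (intro ballI impI)
    fix a b assume ab: "a \<in> metric_supports A d" "b \<in> metric_supports A d" "a \<noteq> b"
    then have V: "a \<in> V" "b \<in> V" using A.supports_subset sub by auto
    consider "a = u'" "b \<in> metric_supports V d \<inter> A" | "b = u'" "a \<in> metric_supports V d \<inter> A"
      | "a \<in> metric_supports V d" "b \<in> metric_supports V d" using ab unfolding S by auto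
    then show "d a b mod 5 = 2"
    proof cases
      case 1
      then show ?thesis using u'S[of b] dist_sym[OF V] by simp
    next
      case 2
      then show ?thesis using u'S[of a] by simp
    next
      case 3
      then show ?thesis using good ab(3) by (simp add: supports_2_mod_5_def)
    qed
  qed
qed

section \<open>Base cases of the converse\<close>

lemma singleton_if_no_supports:
  assumes "metric_supports V d = {}" "c \<in> V"
  shows "V = {c}"
proof (rule ccontr)
  assume "V \<noteq> {c}"
  then obtain y where y: "y \<in> V" "y \<noteq> c" using assms by auto
  then obtain w where "w \<in> V" "d c w = 1" using first_step[of c y] assms by auto
  then show False using support_behind_edge[of c w] assms by auto
qed

text \<open>The midpoint \<open>c\<close> of \<open>x\<close> and \<open>y\<close> is adjacent to
  every support vertex, so it reaches every vertex within 2. The counting reverses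
  \<open>bound_radius_2\<close>: leaves, support vertices and \<open>c\<close> do not
  overlap.\<close>

lemma center_if_supports_dist_2:
  assumes xy: "x \<in> metric_supports V d" "y \<in> metric_supports V d" "x \<noteq> y"
    and dist2: "\<And>a b. a \<in> metric_supports V d \<Longrightarrow> b \<in> metric_supports V d \<Longrightarrow> a \<noteq> b \<Longrightarrow> d a b = 2"
  obtains c where "c \<in> V" "\<And>w. w \<in> V \<Longrightarrow> d w c \<le> 2"
    "1 + card (metric_leaves V d) + card (metric_supports V d) \<le> card V"
proof -
  let ?L = "metric_leaves V d" and ?S = "metric_supports V d"
  have xyV: "x \<in> V" "y \<in> V" using xy supports_subset by auto
  obtain c where c: "c \<in> V" "d x c = 1" "d c y = 1"
    using first_step[of x y] xyV xy dist2[OF xy] by auto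
  have cx: "d c x = 1" using c dist_sym xyV by auto
  have cy: "d y c = 1" using c dist_sym xyV by auto
  have cS1: "d c z = 1" if z: "z \<in> ?S" for z
  proof (cases "z = x \<or> z = y")
    case True
    then show ?thesis using c cx by auto
  next
    case False
    have zV: "z \<in> V" using z supports_subset by auto
    have dz: "d z x = 2" "d z y = 2" using dist2 xy z False by auto
    \<comment> \<open>Otherwise the edge \<open>xc\<close> would separate \<open>z\<close> from
      \<open>y\<close> and \<open>d z y\<close> would be 4.\<close>
    have "\<not> d z x < d z c"
    proof
      assume "d z x < d z c"
      then have "d z y = d z x + 1 + d c y"
        using xyV zV c cy dist2[OF xy] dist_sym[OF xyV] by (intro edge_cut) auto
      then show False using dz by simp
    qed
    then have "d z c = 1" using edge_dist_cases[OF c(1) xyV(1) zV cx] dz by auto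
    then show ?thesis using dist_sym c zV by auto
  qed
  have rad: "d w c \<le> 2" if "w \<in> V" for w
    using eccentricity_le_if_supports_close[OF c(1), of 1 w] cS1 that dist_sym[OF c(1) that] by auto
  have "x \<noteq> c" using c dist_self by auto
  then have cnS: "c \<notin> ?S" using dist2[of x c] xy c by auto
  have cnL: "c \<notin> ?L"
  proof
    assume "c \<in> ?L"
    then show False using leaf_neighbours[of c] xyV cx c xy by metis
  qed
  \<comment> \<open>A leaf next to a leaf would give two support vertices at distance 1.\<close>
  have disj: "?L \<inter> ?S = {}"
  proof (rule ccontr)
    assume "?L \<inter> ?S \<noteq> {}"
    then obtain z l where z: "z \<in> ?L" "z \<in> ?S" "l \<in> ?L" "d z l = 1" 
      by (auto simp: metric_supports_def)
    have V: "z \<in> V" "l \<in> V" using z leaves_subset by auto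
    then have "l \<in> ?S" using z dist_sym[OF V] by (auto simp: metric_supports_def)
    moreover have "z \<noteq> l" using z dist_self V by auto
    ultimately show False using dist2[of z l] z by auto
  qed
  have "card (insert c (?L \<union> ?S)) = 1 + card ?L + card ?S"
    using cnS cnL disj finite_leaves finite_supports by (simp add: card_Un_disjoint)
  moreover have "insert c (?L \<union> ?S) \<subseteq> V" using c leaves_subset supports_subset by auto
  ultimately have "1 + card ?L + card ?S \<le> card V" using card_mono[OF finite_V] by metis
  then show ?thesis using that c rad by blast
qed

section \<open>Branches off a path between two support vertices\<close>

lemma geodesic_degree_2:
  assumes good: "supports_2_mod_5 V d"
    and xy: "p 0 \<in> metric_supports V d" "p D \<in> metric_supports V d" "D mod 5 = 2"
    and p: "\<And>i. i \<le> D \<Longrightarrow> p i \<in> V" "\<And>i j. i \<le> j \<Longrightarrow> j \<le> D \<Longrightarrow> d (p i) (p j) = j - i"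
    and m: "0 < m" "m < D" "m mod 5 \<noteq> 1"
  shows "p m \<notin> metric_supports V d"
    and "\<And>w. w \<in> V \<Longrightarrow> d (p m) w = 1 \<Longrightarrow> w = p (m - 1) \<or> w = p (m + 1)"
proof -
  have V: "p 0 \<in> V" "p D \<in> V" "p m \<in> V" "p (m - 1) \<in> V" "p (m + 1) \<in> V"
    using p(1) m by auto
  \<comment> \<open>A support vertex \<open>z\<close> projecting to \<open>p m\<close> at distance
    \<open>h\<close> would force \<open>m mod 5 = 1\<close>. With \<open>h = 0\<close> this excludes
    \<open>p m\<close> itself, with \<open>h > 0\<close> any branch at \<open>p m\<close>.\<close>
  have no_support: False
    if z: "z \<in> metric_supports V d" "d z (p 0) = h + m" "d z (p D) = h + (D - m)" for z h
  proof -
    have zV: "z \<in> V" using z supports_subset by auto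
    have "z \<noteq> p 0" "z \<noteq> p D" using z dist_self m zV by auto
    then have "(h + m) mod 5 = 2" "(h + (D - m)) mod 5 = 2"
      using good z xy unfolding supports_2_mod_5_def by metis+
    then show False using mod_5_projection(1)[of h m D] m xy(3) by simp
  qed
  show nS: "p m \<notin> metric_supports V d"
    using no_support[of "p m" 0] p(2)[of 0 m] p(2)[of m D] dist_sym[OF V(1) V(3)] m by auto
  fix w assume w: "w \<in> V" "d (p m) w = 1"
  show "w = p (m - 1) \<or> w = p (m + 1)"
  proof (rule ccontr)
    assume neg: "\<not> ?thesis"
    have e: "d (p m) (p (m - 1)) = 1" "d (p m) (p (m + 1)) = 1"
      using p(2)[of "m - 1" m] p(2)[of m "m + 1"] m dist_sym[OF V(3,4)] by auto
    \<comment> \<open>If \<open>w\<close> were closer to \<open>p 0\<close>, it would coincide with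
      \<open>p (m - 1)\<close>, the only neighbour of \<open>p m\<close> that is.\<close>
    have x: "p 0 \<in> edge_side V d (p m) w"
    proof (rule ccontr)
      assume "\<not> ?thesis"
      then have "d (p 0) w < d (p 0) (p m)" using edge_dist_cases[OF V(3) w(1) V(1) w(2)] V by (auto simp: edge_side_def)
      moreover have "d (p 0) (p (m - 1)) < d (p 0) (p m)" using p(2) m by auto
      ultimately have "w = p (m - 1)"
        by (intro closer_neighbour_unique[OF V(1) V(3) w(1) V(4) w(2) _ e(1)])
      then show False using neg by simp
    qed
    have y: "p D \<in> edge_side V d (p m) w"
    proof (rule ccontr)
      assume "\<not> ?thesis"
      then have "d (p D) w < d (p D) (p m)" using edge_dist_cases[OF V(3) w(1) V(2) w(2)] V by (auto simp: edge_side_def)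
      moreover have "d (p D) (p (m + 1)) < d (p D) (p m)"
        using p(2)[of m D] p(2)[of "m + 1" D] m dist_sym[OF V(2) V(3)] dist_sym[OF V(2) V(5)] by auto
      ultimately have "w = p (m + 1)"
        by (intro closer_neighbour_unique[OF V(2) V(3) w(1) V(5) w(2) _ e(2)])
      then show False using neg by simp
    qed
    \<comment> \<open>A branch through \<open>w\<close> contains a support vertex, and that vertex
      projects to \<open>p m\<close>.\<close>
    obtain s where s: "s \<in> metric_supports V d" "s \<in> edge_side V d w (p m)"
      using support_behind_edge[OF V(3) w] nS by auto
    have sV: "s \<in> V" using s supports_subset by auto
    show False
    proof (rule no_support[OF s(1)])
      show "d s (p 0) = (1 + d w s) + m"
        using dist_across[OF V(3) w x s(2)] p(2)[of 0 m] m dist_sym[OF sV V(1)] by simp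
      show "d s (p D) = (1 + d w s) + (D - m)"
        using dist_across[OF V(3) w y s(2)] p(2)[of m D] m dist_sym[OF sV V(2)] dist_sym[OF V(2,3)] by simp
    qed
  qed
qed

text \<open>The two end distances feed \<open>mod_5_projection\<close>. The ends of the path are
  listed separately, because the distance condition says nothing about a vertex and itself.\<close>

lemma support_projection:
  assumes good: "supports_2_mod_5 V d"
    and xy: "p 0 \<in> metric_supports V d" "p D \<in> metric_supports V d" "D mod 5 = 2"
    and p: "\<And>i. i \<le> D \<Longrightarrow> p i \<in> V" "\<And>i j. i \<le> j \<Longrightarrow> j \<le> D \<Longrightarrow> d (p i) (p j) = j - i"
    and z: "z \<in> metric_supports V d"
  obtains i where "i \<le> D" "\<And>k. i \<le> k \<Longrightarrow> k \<le> D \<Longrightarrow> d z (p k) = d z (p i) + (k - i)"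
    "\<And>k. k \<le> i \<Longrightarrow> d z (p k) = d z (p i) + (i - k)"
    "i mod 5 = 1 \<and> d z (p i) mod 5 = 1 \<or> i = 0 \<and> d z (p i) = 0 \<or> i = D \<and> d z (p i) = 0"
proof -
  have zV: "z \<in> V" using z supports_subset by auto
  obtain i where i: "i \<le> D" "\<And>k. i \<le> k \<Longrightarrow> k \<le> D \<Longrightarrow> d z (p k) = d z (p i) + (k - i)"
    "\<And>k. k \<le> i \<Longrightarrow> d z (p k) = d z (p i) + (i - k)"
    using projection_on_geodesic[OF p zV] by blast
  have d0: "d z (p 0) = d z (p i) + i" and dD: "d z (p D) = d z (p i) + (D - i)"
    using i(3)[of 0] i(2)[of D] i(1) by auto
  have "i mod 5 = 1 \<and> d z (p i) mod 5 = 1 \<or> i = 0 \<and> d z (p i) = 0 \<or> i = D \<and> d z (p i) = 0"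
  proof (cases "z = p 0 \<or> z = p D")
    case True
    then show ?thesis using d0 dD dist_self[OF zV] i(1) by auto
  next
    case False
    then have "(d z (p i) + i) mod 5 = 2" "(d z (p i) + (D - i)) mod 5 = 2"
      using good z xy d0 dD unfolding supports_2_mod_5_def by metis+
    then show ?thesis using mod_5_projection xy(3) i(1) by blast
  qed
  then show ?thesis using that i by blast
qed

end

text \<open>Exactly one support vertex means a star, where a single dominating vertex already gives
  \<open>n + 5\<close> on the left, with \<open>n = card V\<close>. The recursion must therefore
  check that neither part becomes a star.\<close>

theorem domination_upper_bound:
  assumes "tree_metric V d" "supports_2_mod_5 V d" "card (metric_supports V d) \<noteq> 1"
  shows "\<exists>X \<subseteq> V. (\<forall>w\<in>V. \<exists>x\<in>X. d w x \<le> 2) \<and>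
    5 * card X + card (metric_leaves V d) + card (metric_supports V d) \<le> card V + 4"
  using assms
proof (induction "card V" arbitrary: V rule: less_induct)
  case less
  interpret tree_metric V d by fact
  note good = less.prems(2)
  let ?L = "metric_leaves V d" and ?S = "metric_supports V d"
  show ?case
  proof (cases "?S = {}")
    case True
    obtain c where c: "c \<in> V" using V_nonempty by auto
    have V: "V = {c}" using singleton_if_no_supports[OF True c] .
    have "?L = {}" using dist_self[OF c] unfolding metric_leaves_def V by auto
    then show ?thesis using True dist_self[OF c] unfolding V by (intro exI[of _ "{c}"]) auto
  next
    case False
    have "\<not> (\<exists>a. ?S = {a})" using less.prems(3) by auto
    then obtain x0 y0 where xy0: "x0 \<in> ?S" "y0 \<in> ?S" "x0 \<noteq> y0" using False by blast
    show ?thesis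
    proof (cases "\<forall>a\<in>?S. \<forall>b\<in>?S. a \<noteq> b \<longrightarrow> d a b = 2")
      case True
      then obtain c where "c \<in> V" "\<And>w. w \<in> V \<Longrightarrow> d w c \<le> 2" "1 + card ?L + card ?S \<le> card V"
        using center_if_supports_dist_2[OF xy0] by metis
      then show ?thesis by (intro exI[of _ "{c}"]) auto
    next
      case False
      then obtain x y where xy: "x \<in> ?S" "y \<in> ?S" "x \<noteq> y" "d x y \<noteq> 2" by auto
      define D where "D = d x y"
      have D5: "D mod 5 = 2" using good xy by (auto simp: supports_2_mod_5_def D_def)
      have "D \<noteq> 2" using xy by (simp add: D_def)
      with D5 have D7: "7 \<le> D" by presburger
      have xyV: "x \<in> V" "y \<in> V" using xy supports_subset by auto
      obtain p where p: "p 0 = x" "p D = y" "\<And>i. i \<le> D \<Longrightarrow> p i \<in> V"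
        "\<And>i j. i \<le> j \<Longrightarrow> j \<le> D \<Longrightarrow> d (p i) (p j) = j - i"
        using geodesic[OF xyV D_def[symmetric]] by blast
      have S: "p 0 \<in> ?S" "p D \<in> ?S" using p xy by auto
      note deg = geodesic_degree_2[OF good S D5 p(3,4)]
      \<comment> \<open>Since \<open>D \<ge> 7\<close>, positions 2 to 5 are interior, and none is 1
        modulo 5, so nothing branches off there. Cutting between 3 and 4 makes \<open>p 2\<close>
        and \<open>p 5\<close> support vertices, at distances 2 and \<open>D - 5\<close> from the
        old ends, both 2 modulo 5.\<close>
      define u v u' v' where "u = p 3" and "v = p 4" and "u' = p 2" and "v' = p 5"
      have V: "u \<in> V" "v \<in> V" "u' \<in> V" "v' \<in> V" using p(3) D7 by (auto simp: u_def v_def u'_def v'_def)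
      have e: "d u v = 1" "d u' u = 1" "d v v' = 1" "d u' v = 2" "d u v' = 2"
        using p(4)[of 3 4] p(4)[of 2 3] p(4)[of 4 5] p(4)[of 2 4] p(4)[of 3 5] D7
        by (auto simp: u_def v_def u'_def v'_def)
      have e': "d v u = 1" "d u u' = 1" "d v' u = 2" "d v' v = 1" using e dist_sym V by metis+
      have dx: "d x u = 3" "d x v = 4" "d x u' = 2"
        using p(1) p(4)[of 0 3] p(4)[of 0 4] p(4)[of 0 2] D7 by (auto simp: u_def v_def u'_def)
      have dy: "d y u = D - 3" "d y v = D - 4" "d y v' = D - 5"
        using p(2) p(4)[of 3 D] p(4)[of 4 D] p(4)[of 5 D] D7 dist_sym[OF xyV(2)] V
        by (auto simp: u_def v_def v'_def)
      let ?A = "edge_side V d u v" and ?B = "edge_side V d v u"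
      have in_sides: "x \<in> ?A" "u' \<in> ?A" "y \<in> ?B" "v' \<in> ?B"
        using V xyV dx dy e e' D7 by (auto simp: edge_side_def)
      have nS: "u \<notin> ?S" "u' \<notin> ?S" "v \<notin> ?S" "v' \<notin> ?S"
        using deg(1)[of 3] deg(1)[of 2] deg(1)[of 4] deg(1)[of 5] D7
        by (auto simp: u_def v_def u'_def v'_def)
      have degu: "z = u' \<or> z = v" if "z \<in> V" "d u z = 1" for z
        using deg(2)[of 3 z] that D7 by (auto simp: u_def v_def u'_def)
      have degv: "z = v' \<or> z = u" if "z \<in> V" "d v z = 1" for z
        using deg(2)[of 4 z] that D7 by (auto simp: u_def v_def v'_def)
      have Su: "d z u' mod 5 = 2" if z: "z \<in> ?S \<inter> ?A" for z
      proof -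
        obtain i where i: "i \<le> D" "\<And>k. i \<le> k \<Longrightarrow> k \<le> D \<Longrightarrow> d z (p k) = d z (p i) + (k - i)"
          "\<And>k. k \<le> i \<Longrightarrow> d z (p k) = d z (p i) + (i - k)"
          "i mod 5 = 1 \<and> d z (p i) mod 5 = 1 \<or> i = 0 \<and> d z (p i) = 0 \<or> i = D \<and> d z (p i) = 0"
          using support_projection[OF good S D5 p(3,4), of z] z by blast
        have "i \<le> 3"
        proof (rule ccontr)
          assume "\<not> i \<le> 3"
          then have "d z u = d z v + 1" using i(3)[of 3] i(3)[of 4] by (simp add: u_def v_def)
          then show False using z by (simp add: edge_side_def)
        qed
        \<comment> \<open>Either \<open>z\<close> sits at height 1 modulo 5 over position 1, or
          \<open>z = p 0\<close>; the distance to \<open>p 2\<close> is then \<open>1 + 1\<close> or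
          \<open>0 + 2\<close> modulo 5.\<close>
        then have "i = 1 \<and> d z (p i) mod 5 = 1 \<or> i = 0 \<and> d z (p i) = 0"
          using i(4) D7 by auto
        then have "d z u' mod 5 = (d z (p i) + (2 - i)) mod 5" "(d z (p i) + (2 - i)) mod 5 = 2"
          using i(2)[of 2] D7 by (auto simp: u'_def mod_Suc)
        then show ?thesis by simp
      qed
      have Sv: "d z v' mod 5 = 2" if z: "z \<in> ?S \<inter> ?B" for z
      proof -
        obtain i where i: "i \<le> D" "\<And>k. i \<le> k \<Longrightarrow> k \<le> D \<Longrightarrow> d z (p k) = d z (p i) + (k - i)"
          "\<And>k. k \<le> i \<Longrightarrow> d z (p k) = d z (p i) + (i - k)"
          "i mod 5 = 1 \<and> d z (p i) mod 5 = 1 \<or> i = 0 \<and> d z (p i) = 0 \<or> i = D \<and> d z (p i) = 0"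
          using support_projection[OF good S D5 p(3,4), of z] z by blast
        have i4: "4 \<le> i"
        proof (rule ccontr)
          assume "\<not> 4 \<le> i"
          then have "d z v = d z u + 1" using i(2)[of 3] i(2)[of 4] D7 by (simp add: u_def v_def)
          then show False using z by (simp add: edge_side_def)
        qed
        \<comment> \<open>Position 4 is neither an end nor 1 modulo 5, so the projection is at
          \<open>p 5\<close> or beyond, \<open>k\<close> steps from it.\<close>
        have "i \<noteq> 4" using i(4) D7 by auto
        then obtain k where k: "i = 5 + k" using i4 le_Suc_ex[of 5 i] by auto
        have "d z v' = d z (p i) + k" using i(3)[of 5] k by (simp add: v'_def)
        moreover have "k mod 5 = 1 \<and> d z (p i) mod 5 = 1 \<or> k mod 5 = 2 \<and> d z (p i) = 0"
          using i(4) k D5 by auto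
        ultimately show ?thesis using mod_add_eq[of "d z (p i)" 5 k] by auto
      qed
      have tA: "tree_metric ?A d" and tB: "tree_metric ?B d"
        using tree_metric_edge_side V e e' by auto
      interpret A: tree_metric ?A d by fact
      interpret B: tree_metric ?B d by fact
      note kA = edge_side_of_degree_2_edge[OF V(1,2) e(1) in_sides(2) e'(2) degu nS(1,2) good Su]
      note kB = edge_side_of_degree_2_edge[OF V(2,1) e'(1) in_sides(4) e(3) degv nS(3,4) good Sv]
      \<comment> \<open>The side keeps the support vertex \<open>x\<close> besides the new
        \<open>u'\<close>, so it has at least two; likewise \<open>y\<close> and \<open>v'\<close>
        on the other side.\<close>
      have sA: "card (metric_supports ?A d) \<noteq> 1" using kA(2,3) nS(2) xy(1) in_sides A.finite_supports
        by (auto simp: card_1_singleton_iff)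
      have sB: "card (metric_supports ?B d) \<noteq> 1" using kB(2,3) nS(4) xy(2) in_sides B.finite_supports
        by (auto simp: card_1_singleton_iff)
      have cV: "card ?A + card ?B = card V"
        using card_edge_sides[OF V(1,2) e(1), of V] by (simp add: edge_side_def Int_def)
      have cL: "card (?L \<inter> ?A) + card (?L \<inter> ?B) = card ?L" using card_edge_sides[OF V(1,2) e(1) leaves_subset] .
      have cS: "card (?S \<inter> ?A) + card (?S \<inter> ?B) = card ?S" using card_edge_sides[OF V(1,2) e(1) supports_subset] .
      have "card ?A > 0" "card ?B > 0" using in_sides A.finite_V B.finite_V by (auto simp: card_gt_0_iff)
      then have less: "card ?A < card V" "card ?B < card V" using cV by linarith+
      obtain X where X: "X \<subseteq> ?A" "\<forall>w\<in>?A. \<exists>x\<in>X. d w x \<le> 2"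
        "5 * card X + card (metric_leaves ?A d) + card (metric_supports ?A d) \<le> card ?A + 4"
        using less.hyps[OF less(1) tA kA(4) sA] by blast
      obtain Y where Y: "Y \<subseteq> ?B" "\<forall>w\<in>?B. \<exists>x\<in>Y. d w x \<le> 2"
        "5 * card Y + card (metric_leaves ?B d) + card (metric_supports ?B d) \<le> card ?B + 4"
        using less.hyps[OF less(2) tB kB(4) sB] by blast
      show ?thesis
      proof (intro exI[of _ "X \<union> Y"] conjI)
        show "X \<union> Y \<subseteq> V" using X Y by (auto simp: edge_side_def)
        show "\<forall>w\<in>V. \<exists>x\<in>X \<union> Y. d w x \<le> 2" using X(2) Y(2) edge_side_Un[OF V(1,2) e(1)] by blast
        \<comment> \<open>The cut creates exactly two leaves and two support vertices, which offsets
          the second 4 in the sum of the two bounds.\<close>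
        show "5 * card (X \<union> Y) + card ?L + card ?S \<le> card V + 4"
          using card_Un_le[of X Y] X(3) Y(3) kA(1,3) kB(1,3) cV cL cS by linarith
      qed
    qed
  qed
qed

section \<open>Stars\<close>

context tree_metric
begin

text \<open>The eccentricity of \<open>c\<close> is at most 1, and \<open>edge_neq\<close> forbids
  edges between two vertices equidistant from \<open>c\<close>. With only one vertex besides
  \<open>c\<close>, that vertex would be a second support vertex.\<close>

lemma star_if_one_support:
  assumes S: "metric_supports V d = {c}"
  shows "c \<in> V" "\<And>a b. a \<in> V \<Longrightarrow> b \<in> V \<Longrightarrow> d a b = 1 \<longleftrightarrow> (a = c) \<noteq> (b = c)" "2 \<le> card (V - {c})"
proof -
  show c: "c \<in> V" using S supports_subset by auto
  have near: "d c w = 1" if w: "w \<in> V" "w \<noteq> c" for w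
  proof -
    have "d c w \<le> Suc 0"
      by (rule eccentricity_le_if_supports_close[OF c _ w(1)]) (use S dist_self[OF c] in auto)
    then show ?thesis using dist_0[OF c w(1)] w by auto
  qed
  show adj: "d a b = 1 \<longleftrightarrow> (a = c) \<noteq> (b = c)" if ab: "a \<in> V" "b \<in> V" for a b
  proof (cases "a = c \<or> b = c")
    case True
    then show ?thesis using near[OF ab(1)] near[OF ab(2)] dist_self[OF c] dist_sym[OF ab] by auto
  next
    case False
    then show ?thesis using edge_neq[OF ab c] near ab by auto
  qed
  obtain l where l: "l \<in> metric_leaves V d" "d c l = 1" using S by (auto simp: metric_supports_def)
  have lV: "l \<in> V" using l leaves_subset by auto
  have lc: "l \<noteq> c" using l dist_self[OF c] by auto
  have "\<not> V - {c} \<subseteq> {l}"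
  proof
    assume sub: "V - {c} \<subseteq> {l}"
    have "\<exists>!w. w \<in> V \<and> d c w = 1"
    proof (rule ex1I[of _ l])
      fix w assume w: "w \<in> V \<and> d c w = 1"
      then have "w \<noteq> c" using dist_self[OF c] by auto
      then show "w = l" using sub w by auto
    qed (use l lV in auto)
    then have "c \<in> metric_leaves V d" using c by (simp add: metric_leaves_def)
    then have "l \<in> metric_supports V d"
      using lV l dist_sym[OF c lV] by (auto simp: metric_supports_def)
    then show False using S lc by auto
  qed
  then obtain y where y: "y \<in> V" "y \<noteq> c" "y \<noteq> l" by auto
  then have "{y, l} \<subseteq> V - {c}" using lV lc by auto
  then have "card {y, l} \<le> card (V - {c})" using finite_V by (intro card_mono) auto
  then show "2 \<le> card (V - {c})" using y by simp
qed

end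

section \<open>The metric of a tree\<close>

context pair_graph
begin

lemma arc_sym: "(u, v) \<in> parcs G \<Longrightarrow> (v, u) \<in> parcs G"
  using pair_sym_arcs by (auto simp: symmetric_def elim: symE)

lemma awalk_rev:
  "awalk u p v \<Longrightarrow> awalk v (rev (map prod.swap p)) u"
proof (induction p arbitrary: u)
  case Nil
  then show ?case by (auto simp: awalk_Nil_iff)
next
  case (Cons e p)
  obtain a b where e: "e = (a, b)" by force
  have *: "(a, b) \<in> parcs G" "a = u" "awalk b p v" using Cons.prems e by (auto simp: awalk_Cons_iff)
  have "awalk v (rev (map prod.swap p)) b" using Cons.IH * by simp
  moreover have "awalk b [(b, a)] a" using * arc_sym by (auto simp: awalk_simps dest: in_arcsD1)
  ultimately show ?case using e * by (auto intro: awalk_appendI)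
qed

text \<open>\<open>gdist\<close> minimises over paths only; a walk with a repeated vertex is
  shortened by deleting a closed subwalk.\<close>

lemma gdist_le: "awalk u p v \<Longrightarrow> gdist G u v \<le> length p"
proof (induction "length p" arbitrary: p rule: less_induct)
  case less
  show ?case
  proof (cases "distinct (pawalk_verts u p)")
    case True
    then have "apath u p v" using less.prems by (simp add: apath_def)
    then show ?thesis unfolding gdist_def by (intro Least_le) auto
  next
    case False
    then obtain q r s w where p: "p = q @ r @ s" "0 < length r" "awalk u q w" "awalk w s v"
      using awalk_not_distinct_decomp[OF less.prems] by blast
    then have "awalk u (q @ s) v" and len: "length (q @ s) < length p"
      using awalk_appendI[of u q w s v] by simp_all
    then have "gdist G u v \<le> length (q @ s)" using less.hyps by blast
    then show ?thesis using len by linarith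
  qed
qed

lemma gdist_awalk:
  assumes "awalk u p v"
  obtains q where "awalk u q v" "length q = gdist G u v"
proof -
  have "\<exists>k q. apath u q v \<and> length q = k" using apath_awalk_to_apath[OF assms] by blast
  then have "\<exists>q. apath u q v \<and> length q = gdist G u v" unfolding gdist_def by (rule LeastI_ex)
  then show ?thesis using that awalkI_apath by blast
qed

lemma out_degree_1_iff: "out_degree (with_proj G) v = 1 \<longleftrightarrow> (\<exists>!w. (v, w) \<in> parcs G)"
proof -
  have "out_arcs (with_proj G) v = Pair v ` {w. (v, w) \<in> parcs G}" by (auto simp: out_arcs_def)
  then have "out_degree (with_proj G) v = card {w. (v, w) \<in> parcs G}"
    by (simp add: out_degree_def card_image inj_on_def)
  then show ?thesis by (auto simp: card_1_singleton_iff set_eq_iff)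
qed

end

locale pair_tree = pair_graph +
  assumes tree: "is_tree G"
begin

lemma awalk_exists:
  assumes "u \<in> pverts G" "v \<in> pverts G"
  obtains p where "awalk u p v"
proof -
  have "strongly_connected (with_proj G)"
    using symmetric_connected_imp_strongly_connected pair_sym_arcs tree by (simp add: is_tree_def)
  then have "u \<rightarrow>\<^sup>*\<^bsub>with_proj G\<^esub> v" using assms by (auto elim: strongly_connectedE)
  then show ?thesis using that reachable_awalk by blast
qed

lemma shortest_awalk:
  assumes "u \<in> pverts G" "v \<in> pverts G"
  obtains p where "awalk u p v" "length p = gdist G u v"
  using awalk_exists[OF assms] gdist_awalk by metis

lemma gdist_eq_0_iff:
  assumes "u \<in> pverts G" "v \<in> pverts G"
  shows "gdist G u v = 0 \<longleftrightarrow> u = v"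
proof
  assume "gdist G u v = 0"
  then show "u = v" using shortest_awalk[OF assms] by (metis awalk_empty_ends length_0_conv)
next
  assume "u = v"
  then show "gdist G u v = 0" using gdist_le[of u "[]" v] assms by (simp add: awalk_Nil_iff)
qed

lemma gdist_triangle:
  assumes "u \<in> pverts G" "v \<in> pverts G" "w \<in> pverts G"
  shows "gdist G u w \<le> gdist G u v + gdist G v w"
proof -
  obtain p where p: "awalk u p v" "length p = gdist G u v" using shortest_awalk assms by blast
  obtain q where q: "awalk v q w" "length q = gdist G v w" using shortest_awalk assms by blast
  show ?thesis using gdist_le[OF awalk_appendI[OF p(1) q(1)]] p q by simp
qed

lemma gdist_sym:
  assumes "u \<in> pverts G" "v \<in> pverts G"
  shows "gdist G u v = gdist G v u"
proof -
  have "gdist G b a \<le> gdist G a b" if ab: "a \<in> pverts G" "b \<in> pverts G" for a b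
  proof -
    obtain p where "awalk a p b" "length p = gdist G a b" using shortest_awalk[OF ab] by blast
    then show ?thesis using gdist_le[OF awalk_rev] by (metis length_map length_rev)
  qed
  then show ?thesis using assms by (simp add: le_antisym)
qed

lemma gdist_eq_1_iff:
  assumes "u \<in> pverts G" "v \<in> pverts G"
  shows "gdist G u v = 1 \<longleftrightarrow> (u, v) \<in> parcs G"
proof
  assume *: "gdist G u v = 1"
  obtain p where p: "awalk u p v" "length p = gdist G u v" using shortest_awalk[OF assms] by blast
  then obtain e where "p = [e]" using * by (auto simp: length_Suc_conv)
  then show "(u, v) \<in> parcs G" using p by (cases e) (auto simp: awalk_simps)
next
  assume e: "(u, v) \<in> parcs G"
  then have "awalk u [(u, v)] v" using assms by (simp add: awalk_simps)
  then have "gdist G u v \<le> 1" using gdist_le[of u "[(u, v)]" v] by simp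
  moreover have "u \<noteq> v" using pair_no_loops[OF e] by simp
  ultimately show "gdist G u v = 1" using gdist_eq_0_iff[OF assms] by linarith
qed

lemma gdist_first_step:
  assumes "u \<in> pverts G" "v \<in> pverts G" "u \<noteq> v"
  shows "\<exists>w\<in>pverts G. gdist G u w = 1 \<and> gdist G u v = Suc (gdist G w v)"
proof -
  obtain p where p: "awalk u p v" "length p = gdist G u v" using shortest_awalk assms by blast
  then obtain w q where q: "p = (u, w) # q" "(u, w) \<in> parcs G" "awalk w q v"
    using assms(3) by (cases p) (auto simp: awalk_simps)
  have w: "w \<in> pverts G" using q in_arcsD2 by auto
  have 1: "gdist G u w = 1" using gdist_eq_1_iff[OF assms(1) w] q by simp
  then have "gdist G u v = Suc (gdist G w v)"
    using gdist_le[OF q(3)] gdist_triangle[OF assms(1) w assms(2)] p q by simp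
  then show ?thesis using w 1 by blast
qed

section \<open>Removing an edge of a tree\<close>

lemma no_detour:
  assumes e: "(u, v) \<in> parcs G" and p: "awalk u p v" "(u, v) \<notin> set p"
  shows False
proof -
  define q where "q = awalk_to_apath p"
  have q: "apath u q v" "(u, v) \<notin> set q"
    using apath_awalk_to_apath[OF p(1)] awalk_to_apath_subset[OF p(1)] p(2) by (auto simp: q_def)
  have aw: "awalk u q v" and dist: "distinct (pawalk_verts u q)" using q by (auto simp: apath_def)
  have "q \<noteq> []" using aw pair_no_loops[OF e] by (auto simp: awalk_Nil_iff)
  moreover have "\<not> (\<exists>a. q = [a])" using aw q(2) by (auto simp: awalk_simps)
  \<comment> \<open>The path is not empty, as there are no loops, and not the single arc
    \<open>(u, v)\<close>. Closing it with \<open>(v, u)\<close> therefore gives a cycle of length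
    at least 3.\<close>
  ultimately have len: "2 \<le> length q" by (cases q rule: remdups_adj.cases) auto
  have vu: "awalk v [(v, u)] u" using arc_sym[OF e] by (auto simp: awalk_simps dest: in_arcsD1 in_arcsD2)
  have cyc: "awalk u (q @ [(v, u)]) u" using awalk_appendI[OF aw vu] .
  have "pawalk_verts u (q @ [(v, u)]) = pawalk_verts u q @ [u]"
    using awalk_verts_append[OF cyc] by simp
  moreover obtain vs where vs: "pawalk_verts u q = u # vs"
    using awhd_of_awalk[OF aw] by (cases "pawalk_verts u q") auto
  ultimately have "distinct (tl (pawalk_verts u (q @ [(v, u)])))" using dist by simp
  then have "cycle (q @ [(v, u)])" using cyc unfolding cycle_def by auto
  then show False using tree len unfolding is_tree_def by force
qed

text \<open>Connectivity in the graph without the undirected edge \<open>uv\<close>, hence avoiding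
  both arcs, expressed by walks of \<open>G\<close> itself.\<close>

definition detached_walk :: "'a \<Rightarrow> 'a \<Rightarrow> 'a \<Rightarrow> 'a \<Rightarrow> bool" where
  "detached_walk u v w x \<longleftrightarrow> (\<exists>p. awalk w p x \<and> (u, v) \<notin> set p \<and> (v, u) \<notin> set p)"

lemma detached_walk_sym: "detached_walk u v w x \<Longrightarrow> detached_walk u v x w"
  unfolding detached_walk_def by (elim exE, rule exI, intro conjI, elim conjE, erule awalk_rev) auto

lemma detached_walk_trans: "detached_walk u v w x \<Longrightarrow> detached_walk u v x y \<Longrightarrow> detached_walk u v w y"
  unfolding detached_walk_def by (metis Un_iff awalk_appendI set_append)

lemma not_detached_ends: "(u, v) \<in> parcs G \<Longrightarrow> detached_walk u v u v \<Longrightarrow> False"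
  unfolding detached_walk_def using no_detour by blast

lemma detached_walk_swap: "detached_walk u v = detached_walk v u"
  unfolding detached_walk_def by (intro ext) blast

text \<open>Splitting at the first use of the edge leaves an initial piece that avoids it.\<close>

lemma first_crossing:
  assumes "awalk w p x" "\<not> detached_walk u v w x"
  obtains q e r where "p = q @ e # r" "e = (u, v) \<or> e = (v, u)"
    "awalk w q (fst e)" "detached_walk u v w (fst e)" "awalk (snd e) r x"
proof -
  have "\<exists>e\<in>set p. e = (u, v) \<or> e = (v, u)"
    using assms unfolding detached_walk_def by auto
  then obtain q e r where p: "p = q @ e # r" "e = (u, v) \<or> e = (v, u)"
    "\<forall>y\<in>set q. \<not> (y = (u, v) \<or> y = (v, u))"
    using split_list_first_prop[of p "\<lambda>e. e = (u, v) \<or> e = (v, u)"] by blast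
  have aw: "awalk w q (fst e)" "awalk (snd e) r x" using assms(1) p(1) by (auto simp: awalk_Cons_iff)
  then have "detached_walk u v w (fst e)" unfolding detached_walk_def using p(3) by blast
  then show ?thesis using that p aw by blast
qed

text \<open>Follow a walk from \<open>w\<close> to \<open>u\<close> up to its first use of the edge,
  if there is one: that use starts at \<open>u\<close> or \<open>v\<close>.\<close>

lemma detached_side:
  assumes "u \<in> pverts G" "w \<in> pverts G"
  shows "detached_walk u v w u \<or> detached_walk u v w v"
proof (rule ccontr)
  assume neg: "\<not> ?thesis"
  obtain p where "awalk w p u" using awalk_exists[OF assms(2,1)] by blast
  then obtain q e r where "p = q @ e # r" "e = (u, v) \<or> e = (v, u)" "detached_walk u v w (fst e)"
    using first_crossing[of w p u u v] neg by blast
  then show False using neg by auto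
qed

text \<open>A shortest walk from \<open>w\<close> to \<open>v\<close> must use the edge, first from
  \<open>u\<close> to \<open>v\<close>; its proper initial piece ends in \<open>u\<close>.\<close>

lemma detached_closer:
  assumes e: "(u, v) \<in> parcs G" and w: "detached_walk u v w u"
  shows "gdist G w u < gdist G w v"
proof -
  have V: "w \<in> pverts G" "v \<in> pverts G"
    using w e in_arcsD2 unfolding detached_walk_def by (auto dest: awalk_hd_in_verts)
  have nv: "\<not> detached_walk u v w v"
    using w not_detached_ends[OF e] detached_walk_sym detached_walk_trans by blast
  obtain p where p: "awalk w p v" "length p = gdist G w v" using shortest_awalk[OF V] by blast
  obtain q f r where q: "p = q @ f # r" "f = (u, v) \<or> f = (v, u)" "awalk w q (fst f)"
    "detached_walk u v w (fst f)" "awalk (snd f) r v" by (rule first_crossing[OF p(1) nv])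
  then have "awalk w q u" using nv by auto
  then show ?thesis using gdist_le[of w q u] p q(1) by simp
qed

text \<open>A shortest walk from \<open>w\<close> to \<open>z\<close> splits at its first crossing,
  which goes from \<open>u\<close> to \<open>v\<close>. The other inequality is the triangle
  inequality.\<close>

lemma detached_across:
  assumes e: "(u, v) \<in> parcs G" and w: "detached_walk u v w u" and z: "detached_walk u v z v"
  shows "gdist G w z = gdist G w u + 1 + gdist G v z"
proof -
  have V: "u \<in> pverts G" "v \<in> pverts G" "w \<in> pverts G" "z \<in> pverts G"
    using w z e in_arcsD1 in_arcsD2 unfolding detached_walk_def by (auto dest: awalk_hd_in_verts)
  have nv: "\<not> detached_walk u v w v" 
    using w not_detached_ends[OF e] detached_walk_sym detached_walk_trans by blast
  then have nz: "\<not> detached_walk u v w z" using z detached_walk_trans by blast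
  obtain p where p: "awalk w p z" "length p = gdist G w z" using shortest_awalk[OF V(3,4)] by blast
  obtain q f r where q: "p = q @ f # r" "f = (u, v) \<or> f = (v, u)" "awalk w q (fst f)"
    "detached_walk u v w (fst f)" "awalk (snd f) r z" by (rule first_crossing[OF p(1) nz])
  then have "awalk w q u" "awalk v r z" using nv by auto
  then have "gdist G w u + 1 + gdist G v z \<le> gdist G w z"
    using gdist_le[of w q u] gdist_le[of v r z] p q(1) by simp
  moreover have "gdist G u v = 1" using gdist_eq_1_iff[OF V(1,2)] e by simp
  ultimately show ?thesis
    using gdist_triangle[OF V(3,1,4)] gdist_triangle[OF V(1,2,4)] by linarith
qed

text \<open>Every vertex is joined to an end of \<open>uv\<close> without using that edge, and this
  end is strictly closer. So comparing distances identifies the component, and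
  \<open>detached_across\<close> gives \<open>edge_cut\<close>.\<close>

lemma tree_metric_gdist: "tree_metric (pverts G) (gdist G)"
proof
  show "finite (pverts G)" by (rule pair_finite_verts)
  show "pverts G \<noteq> {}"
    using tree unfolding is_tree_def Digraph_Component.connected_def strongly_connected_def by simp
next
  fix u v w
  assume V: "u \<in> pverts G" "v \<in> pverts G" "w \<in> pverts G" and uv: "gdist G u v = 1"
  have e: "(u, v) \<in> parcs G" using gdist_eq_1_iff V uv by simp
  show "gdist G w u \<noteq> gdist G w v"
    using detached_side[OF V(1,3), of v] detached_closer[OF e, of w]
      detached_closer[OF arc_sym[OF e], of w] detached_walk_swap[of u v] by auto
  fix z assume z: "z \<in> pverts G" and lt: "gdist G w u < gdist G w v" "gdist G z v < gdist G z u"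
  have "detached_walk u v w u"
    using detached_side[OF V(1,3), of v] detached_closer[OF arc_sym[OF e], of w]
      detached_walk_swap[of u v] lt by auto
  moreover have "detached_walk u v z v"
    using detached_side[OF V(1) z, of v] detached_closer[OF e, of z] lt by auto
  ultimately show "gdist G w z = gdist G w u + 1 + gdist G v z" by (rule detached_across[OF e])
qed (rule gdist_eq_0_iff gdist_sym gdist_triangle gdist_first_step; assumption)+

sublocale tree_metric "pverts G" "gdist G"
  by (rule tree_metric_gdist)

section \<open>Leaves, domination and stars expressed by the metric\<close>

lemma leaves_eq: "leaves G = metric_leaves (pverts G) (gdist G)"
proof -
  have "(v, w) \<in> parcs G \<longleftrightarrow> w \<in> pverts G \<and> gdist G v w = 1" if "v \<in> pverts G" for v w
    using gdist_eq_1_iff[OF that] in_arcsD2 by blast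
  then show ?thesis
    unfolding leaves_def metric_leaves_def out_degree_1_iff by (intro Collect_cong conj_cong refl) simp
qed

lemma support_verts_eq: "support_verts G = metric_supports (pverts G) (gdist G)"
proof -
  have "l \<in> pverts G" if "l \<in> leaves G" for l using that by (simp add: leaves_def)
  then show ?thesis
    unfolding support_verts_def metric_supports_def leaves_eq[symmetric]
    using gdist_eq_1_iff by blast
qed

lemma distance_dominating_iff:
  "distance_dominating k G X \<longleftrightarrow> X \<subseteq> pverts G \<and> (\<forall>w\<in>pverts G. \<exists>x\<in>X. gdist G w x \<le> k)"
proof -
  have "\<exists>x\<in>X. gdist G w x \<le> k" if "w \<in> X" "w \<in> pverts G" for w
    using that gdist_eq_0_iff[of w w] by (intro bexI[of _ w]) auto
  then show ?thesis unfolding distance_dominating_def by blast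
qed

lemma distance_domination_number_attained:
  obtains X where "distance_dominating k G X" "card X = distance_domination_number k G"
proof -
  have "distance_dominating k G (pverts G)" by (simp add: distance_dominating_def)
  then have "\<exists>m X. distance_dominating k G X \<and> card X = m" by blast
  then have "\<exists>X. distance_dominating k G X \<and> card X = distance_domination_number k G"
    unfolding distance_domination_number_def by (rule LeastI_ex)
  then show ?thesis using that by blast
qed

lemma distance_domination_number_le:
  "distance_dominating k G X \<Longrightarrow> distance_domination_number k G \<le> card X"
  unfolding distance_domination_number_def by (intro Least_le) blast

lemma star_counts:
  assumes K: "complete_bipartite_digraph 1 m (with_proj G)" and m: "2 \<le> m"
  shows "card (pverts G) = m + 1" "card (leaves G) = m" "card (support_verts G) = 1"
proof -
  obtain c W where W: "pverts G = {c} \<union> W" "c \<notin> W" "card W = m"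
    "parcs G = {c} \<times> W \<union> W \<times> {c}"
    using K unfolding complete_bipartite_digraph_pair_def by (auto simp: card_1_singleton_iff)
  have finW: "finite W" using W pair_finite_verts by simp
  then show "card (pverts G) = m + 1" using W by simp
  have "\<not> (\<exists>!w. (c, w) \<in> parcs G)"
  proof
    assume "\<exists>!w. (c, w) \<in> parcs G"
    then have "\<exists>!w. w \<in> W" using W(2,4) by auto
    then have "card W = 1" by (auto simp: card_1_singleton_iff)
    then show False using W m by simp
  qed
  moreover have "\<exists>!x. (w, x) \<in> parcs G" if "w \<in> W" for w using that W(2,4) by auto
  ultimately have L: "leaves G = W" unfolding leaves_def out_degree_1_iff W(1) by blast
  then show "card (leaves G) = m" using W by simp
  have "W \<noteq> {}" using W m by auto
  then have "support_verts G = {c}" unfolding support_verts_def L using W by auto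
  then show "card (support_verts G) = 1" by simp
qed

text \<open>Turns the exclusion of stars from the family into a condition on the number of support
  vertices, which can be checked for each part of a cut.\<close>

lemma star_iff_one_support:
  "(\<exists>m\<ge>2. complete_bipartite_digraph 1 m (with_proj G)) \<longleftrightarrow> card (support_verts G) = 1"
proof
  assume "card (support_verts G) = 1"
  then obtain c where "metric_supports (pverts G) (gdist G) = {c}"
    unfolding support_verts_eq by (auto simp: card_1_singleton_iff)
  note star = star_if_one_support[OF this]
  have "(a, b) \<in> parcs G \<longleftrightarrow> a \<in> pverts G \<and> b \<in> pverts G \<and> (a = c) \<noteq> (b = c)" for a b
    using star(2)[of a b] gdist_eq_1_iff[of a b] in_arcsD1 in_arcsD2 by blast
  then have arcs: "parcs G = {c} \<times> (pverts G - {c}) \<union> (pverts G - {c}) \<times> {c}"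
    using star(1) by auto
  have "complete_bipartite_digraph 1 (card (pverts G - {c})) (with_proj G)"
    unfolding complete_bipartite_digraph_pair_def
  proof (rule conjI[OF pair_finite_verts], rule exI[of _ "{c}"], rule exI[of _ "pverts G - {c}"], intro conjI)
    show "pverts G = {c} \<union> (pverts G - {c})" using star(1) by blast
  qed (use arcs in simp_all)
  then show "\<exists>m\<ge>2. complete_bipartite_digraph 1 m (with_proj G)" using star(3) by blast
qed (use star_counts in auto)

end

theorem theorem1p3:
  fixes T :: "'a pair_pre_digraph" and n l s :: nat
  assumes "is_tree T"
    and "n = card (pverts T)"
    and "l = card (leaves T)"
    and "s = card (support_verts T)"
  shows "real (distance_domination_number 2 T) \<ge> (real n - real l - real s + 4) / 5 \<and>
    (real (distance_domination_number 2 T) = (real n - real l - real s + 4) / 5 \<longleftrightarrow> T \<in> family_F2)"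
proof -
  interpret pair_tree T
    using assms(1) by (simp add: pair_tree_def pair_tree_axioms_def is_tree_def)
  let ?N = "distance_domination_number 2 T"
  have F2: "T \<in> family_F2 \<longleftrightarrow> supports_2_mod_5 (pverts T) (gdist T) \<and> s \<noteq> 1"
    using tree star_iff_one_support assms(4)
    unfolding family_F2_def supports_2_mod_5_def support_verts_eq[symmetric] by auto
  obtain X where X: "distance_dominating 2 T X" "card X = ?N"
    using distance_domination_number_attained by blast
  then have low: "n + 4 \<le> 5 * ?N + l + s \<and>
      (n + 4 = 5 * ?N + l + s \<longrightarrow> supports_2_mod_5 (pverts T) (gdist T))"
    using domination_lower_bound[OF tree_metric_gdist, of X] assms(2-4)
    unfolding leaves_eq support_verts_eq distance_dominating_iff by auto
  \<comment> \<open>The equality clause of the lower bound gives only the distance condition, which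
    stars satisfy vacuously. For a star equality would read \<open>m + 5 = 5 * ?N + m + 1\<close>,
    making 4 divisible by 5.\<close>
  have not_star: "s \<noteq> 1" if eq: "n + 4 = 5 * ?N + l + s"
  proof
    assume "s = 1"
    then obtain m where "2 \<le> m" "complete_bipartite_digraph 1 m (with_proj T)"
      using star_iff_one_support assms(4) by auto
    then have "n = m + 1" "l = m" using star_counts assms by auto
    then show False using eq \<open>s = 1\<close> by presburger
  qed
  have up: "5 * ?N + l + s \<le> n + 4" if F: "T \<in> family_F2"
  proof -
    have "\<exists>Y. distance_dominating 2 T Y \<and> 5 * card Y + l + s \<le> n + 4"
      using domination_upper_bound[OF tree_metric_gdist] F F2 assms(2-4)
      unfolding leaves_eq support_verts_eq distance_dominating_iff by simp
    then obtain Y where Y: "distance_dominating 2 T Y" "5 * card Y + l + s \<le> n + 4" by blast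
    then show ?thesis using distance_domination_number_le[OF Y(1)] by linarith
  qed
  have "n + 4 = 5 * ?N + l + s \<longleftrightarrow> T \<in> family_F2"
    using low up not_star F2 by (meson le_antisym)
  moreover have "real ?N = (real n - real l - real s + 4) / 5 \<longleftrightarrow> n + 4 = 5 * ?N + l + s"
    by (simp add: field_simps) linarith
  moreover have "(real n - real l - real s + 4) / 5 \<le> real ?N" using low by (simp add: field_simps)
  ultimately show ?thesis by simp
qed

end
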